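(* Let $T=(T_1,\ldots,T_n)\in \mathfrak{B}^n_0(\mathcal{H})$ and suppose $\dim \mathcal{D}_{T_i}<\infty$ for all $i=1,\ldots,n$. Then there exists a one-dimensional symmetric algebraic variety $W$ in $\mathbb{C}^n$ such that for all polynomials $p\in\mathbb{C}[z_1,\ldots,z_n]$, $$\|p(T)\|_{\mathcal{B}(\mathcal{H})}\le \sup_{\boldsymbol{z}\in W\cap\overline{\mathbb{D}}^n}|p(\boldsymbol{z})|.$$
   Context: All Hilbert spaces are complex and separable; $\mathcal{B}(\mathcal{H})$ is the algebra of bounded operators on the Hilbert space $\mathcal{H}$; $n\ge 2$; $\mathbb{D}$ is the open unit disc. A contraction $S$ is called pure if $S^{*k}\to 0$ in the strong operator topology as $k\to\infty$. The class $\mathfrak{B}^n_0(\mathcal{H})$ is the set of all $n$-tuples $T=(T_1,\ldots,T_n)$ of commuting contractions on $\mathcal{H}$ such that $I-T_iT_i^*-T_jT_j^*+T_iT_jT_i^*T_j^*=0$ for all $i\neq j$, and the product $P_T=T_1\cdots T_n$ is pure. For a contraction $S$ on $\mathcal{H}$, the defect operator is $D_S=(I-SS^* )^{1/2}$ and the defect space is $\mathcal{D}_S=\overline{\mathrm{ran}}\,D_S$. An algebraic variety $W\subseteq\mathbb{C}^n$ is called symmetric if, for points with all coordinates nonzero, $(z_1,\ldots,z_n)\in W$ if and only if $(1/\bar z_1,\ldots,1/\bar z_n)\in W$. *)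

theory Defs
  imports
    "HOL-Analysis.Analysis"
    "HOL-Library.Poly_Mapping"
    "HOL-Library.Extended_Nat"
    "HOL-Library.Extended_Real"
begin

section \<open>Complex Hilbert spaces\<close>

text \<open>
  The Hermitian form is linear in its first argument. Positivity of the form and the relation
  between norm and form come from \<^class>\<open>real_inner\<close> through the last axiom.
\<close>

class chilbert_space = real_inner + complete_space +
  fixes scaleC :: "complex \<Rightarrow> 'a \<Rightarrow> 'a" (infixr \<open>*\<^sub>C\<close> 75)
    and cinner :: "'a \<Rightarrow> 'a \<Rightarrow> complex"
  assumes scaleC_add_right: "c *\<^sub>C (x + y) = c *\<^sub>C x + c *\<^sub>C y"
    and scaleC_add_left: "(c + d) *\<^sub>C x = c *\<^sub>C x + d *\<^sub>C x"
    and scaleC_scaleC: "c *\<^sub>C (d *\<^sub>C x) = (c * d) *\<^sub>C x"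
    and scaleC_of_real: "complex_of_real r *\<^sub>C x = r *\<^sub>R x"
    and cinner_commute: "cinner x y = cnj (cinner y x)"
    and cinner_add_left: "cinner (x + y) z = cinner x z + cinner y z"
    and cinner_scaleC_left: "cinner (c *\<^sub>C x) y = c * cinner x y"
    and Re_cinner: "Re (cinner x y) = x \<bullet> y"

lemma scaleC_one: "1 *\<^sub>C x = (x :: 'h::chilbert_space)"
  using scaleC_of_real[of 1 x] by simp

global_interpretation complex_vector: vector_space "scaleC :: complex \<Rightarrow> 'h \<Rightarrow> 'h::chilbert_space"
  defines cspan = complex_vector.span
  by unfold_locales
    (simp_all add: scaleC_add_right scaleC_add_left scaleC_scaleC scaleC_one)

definition finite_cdim :: "'h::chilbert_space set \<Rightarrow> bool" where
  "finite_cdim V \<longleftrightarrow> (\<exists>B. finite B \<and> V = cspan B)"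

section \<open>Bounded operators\<close>

definition bounded_clinear :: "('h::chilbert_space \<Rightarrow> 'h) \<Rightarrow> bool" where
  "bounded_clinear S \<longleftrightarrow> bounded_linear S \<and> (\<forall>c x. S (c *\<^sub>C x) = c *\<^sub>C S x)"

definition cadjoint :: "('h::chilbert_space \<Rightarrow> 'h) \<Rightarrow> 'h \<Rightarrow> 'h" where
  "cadjoint S = (THE R. \<forall>x y. cinner (S x) y = cinner x (R y))"

definition contraction :: "('h::chilbert_space \<Rightarrow> 'h) \<Rightarrow> bool" where
  "contraction S \<longleftrightarrow> bounded_clinear S \<and> onorm S \<le> 1"

definition pure_operator :: "('h::chilbert_space \<Rightarrow> 'h) \<Rightarrow> bool" where
  "pure_operator S \<longleftrightarrow> (\<forall>x. (\<lambda>k. (cadjoint S ^^ k) x) \<longlonglongrightarrow> 0)"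

definition positive_operator :: "('h::chilbert_space \<Rightarrow> 'h) \<Rightarrow> bool" where
  "positive_operator A \<longleftrightarrow> bounded_clinear A \<and> (\<forall>x. cinner (A x) x \<in> \<real>\<^sub>\<ge>\<^sub>0)"

definition operator_sqrt :: "('h::chilbert_space \<Rightarrow> 'h) \<Rightarrow> 'h \<Rightarrow> 'h" where
  "operator_sqrt A = (THE B. positive_operator B \<and> B \<circ> B = A)"

definition defect_operator :: "('h::chilbert_space \<Rightarrow> 'h) \<Rightarrow> 'h \<Rightarrow> 'h" where
  "defect_operator S = operator_sqrt (\<lambda>x. x - S (cadjoint S x))"

definition defect_space :: "('h::chilbert_space \<Rightarrow> 'h) \<Rightarrow> 'h set" where
  "defect_space S = closure (range (defect_operator S))"

section \<open>Tuples of commuting operators\<close>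

text \<open>
  Compositions over the index type are only used for commuting tuples, where the order of the
  factors, which \<^const>\<open>Finite_Set.fold\<close> leaves open, does not matter.
\<close>

definition operator_monomial :: "('n::finite \<Rightarrow> 'h \<Rightarrow> 'h) \<Rightarrow> ('n \<Rightarrow> nat) \<Rightarrow> 'h \<Rightarrow> 'h::chilbert_space" where
  "operator_monomial T m = Finite_Set.fold (\<lambda>i R. (T i ^^ m i) \<circ> R) id UNIV"

definition operator_product :: "('n::finite \<Rightarrow> 'h \<Rightarrow> 'h) \<Rightarrow> 'h \<Rightarrow> 'h::chilbert_space" where
  "operator_product T = operator_monomial T (\<lambda>_. 1)"

definition class_B0 :: "('n::finite \<Rightarrow> 'h \<Rightarrow> 'h::chilbert_space) set" where
  "class_B0 = {T.
     (\<forall>i. contraction (T i)) \<and>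
     (\<forall>i j. T i \<circ> T j = T j \<circ> T i) \<and>
     (\<forall>i j. i \<noteq> j \<longrightarrow> (\<forall>x.
        x - T i (cadjoint (T i) x) - T j (cadjoint (T j) x)
          + T i (T j (cadjoint (T i) (cadjoint (T j) x))) = 0)) \<and>
     pure_operator (operator_product T)}"

section \<open>Polynomials and algebraic varieties\<close>

text \<open>A polynomial maps exponent vectors, which have type \<open>'n \<Rightarrow>\<^sub>0 nat\<close>, to coefficients.\<close>

type_synonym 'n cpoly = "('n \<Rightarrow>\<^sub>0 nat) \<Rightarrow>\<^sub>0 complex"

definition poly_eval :: "'n::finite cpoly \<Rightarrow> complex ^ 'n \<Rightarrow> complex" where
  "poly_eval p z = (\<Sum>m\<in>Poly_Mapping.keys p.
     Poly_Mapping.lookup p m * (\<Prod>i\<in>UNIV. (z $ i) ^ Poly_Mapping.lookup m i))"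

definition poly_operator :: "'n::finite cpoly \<Rightarrow> ('n \<Rightarrow> 'h \<Rightarrow> 'h) \<Rightarrow> 'h \<Rightarrow> 'h::chilbert_space" where
  "poly_operator p T x = (\<Sum>m\<in>Poly_Mapping.keys p.
     Poly_Mapping.lookup p m *\<^sub>C operator_monomial T (Poly_Mapping.lookup m) x)"

definition algebraic_variety :: "(complex ^ 'n::finite) set \<Rightarrow> bool" where
  "algebraic_variety W \<longleftrightarrow> (\<exists>P. W = {z. \<forall>p\<in>P. poly_eval p z = 0})"

definition irreducible_variety :: "(complex ^ 'n::finite) set \<Rightarrow> bool" where
  "irreducible_variety Z \<longleftrightarrow> algebraic_variety Z \<and> Z \<noteq> {} \<and>
     (\<forall>A B. algebraic_variety A \<longrightarrow> algebraic_variety B \<longrightarrow> Z = A \<union> B \<longrightarrow> Z = A \<or> Z = B)"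

text \<open>
  Dimension as the supremum of the lengths of chains
  \<open>Z 0 \<subset> Z 1 \<subset> \<dots> \<subset> Z k\<close> of irreducible closed subsets. A variety of dimension \<open>d\<close> need not be
  irreducible or equidimensional. The empty set gets dimension 0.
\<close>

definition variety_dim :: "(complex ^ 'n::finite) set \<Rightarrow> enat" where
  "variety_dim W = Sup {enat k | k. \<exists>Z.
     (\<forall>i\<le>k. irreducible_variety (Z i) \<and> Z i \<subseteq> W) \<and> (\<forall>i<k. Z i \<subset> Z (Suc i))}"

definition symmetric_variety :: "(complex ^ 'n::finite) set \<Rightarrow> bool" where
  "symmetric_variety W \<longleftrightarrow>
     (\<forall>z. (\<forall>i. z $ i \<noteq> 0) \<longrightarrow> (z \<in> W \<longleftrightarrow> (\<chi> i. 1 / cnj (z $ i)) \<in> W))"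

definition closed_polydisc :: "(complex ^ 'n::finite) set" where
  "closed_polydisc = {z. \<forall>i. cmod (z $ i) \<le> 1}"

end

theory Submission
  imports Defs "HOL-Computational_Algebra.Fundamental_Theorem_Algebra"
begin

text \<open>
  Put \<open>\<Delta>\<^sub>i = 1 - T\<^sub>i T\<^sub>i\<^sup>*\<close>. The hypothesis on pairs says \<open>T\<^sub>j \<Delta>\<^sub>i T\<^sub>j\<^sup>* = \<Delta>\<^sub>i\<close> for \<open>j \<noteq> i\<close>. Since \<open>\<Delta>\<^sub>i\<close> has
  finite rank, the operators \<open>T\<^sub>j\<close> with \<open>j \<noteq> i\<close> are simultaneously diagonalisable on its range, with
  unimodular eigenvalues, and \<open>\<Delta>\<^sub>i = \<Sum>\<^sub>f f \<otimes> f\<close> over finitely many joint eigenvectors. Telescoping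
  \<open>1 - P\<^sub>T P\<^sub>T\<^sup>* = \<Sum>\<^sub>i \<Delta>\<^sub>i\<close> with purity of \<open>P\<^sub>T\<close> gives \<open>\<parallel>h\<parallel>\<^sup>2 = \<Sum>\<^sub>i \<Sum>\<^sub>f \<Sum>\<^sub>k \<bar>\<langle>h, T\<^sub>i\<^sup>k f\<rangle>\<bar>\<^sup>2\<close>. On each sequence
  \<open>\<langle>h, T\<^sub>i\<^sup>k f\<rangle>\<close> the adjoint of \<open>p(T)\<close> acts as a polynomial in the backward shift, obtained by restricting
  \<open>p\<close> to the line on which the coordinates \<open>z\<^sub>j\<close>, \<open>j \<noteq> i\<close>, equal the eigenvalues of \<open>f\<close>. So the scalar von
  Neumann inequality applies, and \<open>W\<close> is the union of these lines.
\<close>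

section \<open>Complex Hilbert spaces\<close>

abbreviation clinear :: "('h::chilbert_space \<Rightarrow> 'h) \<Rightarrow> bool" where
  "clinear \<equiv> Vector_Spaces.linear scaleC scaleC"

lemma clinearI:
  assumes "\<And>x y. L (x + y) = L x + L y" "\<And>c x. L (c *\<^sub>C x) = c *\<^sub>C L x"
  shows "clinear L"
  by unfold_locales (use assms in \<open>simp_all add: scaleC_add_right scaleC_add_left scaleC_scaleC scaleC_one\<close>)

context
  fixes L :: "'h::chilbert_space \<Rightarrow> 'h"
  assumes L: "clinear L"
begin

interpretation L: Vector_Spaces.linear scaleC scaleC L by (rule L)

lemmas clinear_add = L.add
lemmas clinear_scale = L.scale
lemmas clinear_diff = L.diff
lemmas clinear_zero = L.zero

end

lemma clinear_compose: "clinear L \<Longrightarrow> clinear M \<Longrightarrow> clinear (L \<circ> M)"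
  by (intro clinearI) (simp_all add: clinear_add clinear_scale)

lemma clinear_funpow: "clinear L \<Longrightarrow> clinear (L ^^ k)"
  by (induction k) (auto intro: clinear_compose clinearI)

lemma bounded_clinear_imp_clinear: "bounded_clinear S \<Longrightarrow> clinear S"
  unfolding bounded_clinear_def
  by (intro clinearI) (auto simp: bounded_linear.axioms(1) linear_add bounded_linear.linear)

lemma cinner_add_right: "cinner x (y + z) = cinner x y + cinner x z"
  by (metis cinner_add_left cinner_commute complex_cnj_add)

lemma cinner_scaleC_right: "cinner x (c *\<^sub>C y) = cnj c * cinner x y"
  by (metis cinner_scaleC_left cinner_commute complex_cnj_mult)

lemma cinner_zero_left [simp]: "cinner 0 x = 0"
  using cinner_add_left[of 0 0 x] by simp

lemma cinner_zero_right [simp]: "cinner x 0 = 0"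
  using cinner_add_right[of x 0 0] by simp

lemma cinner_minus_left: "cinner (- x) y = - cinner x y"
  using cinner_add_left[of x "- x" y] by (simp add: eq_neg_iff_add_eq_0 add.commute)

lemma cinner_minus_right: "cinner x (- y) = - cinner x y"
  by (metis cinner_minus_left cinner_commute complex_cnj_minus)

lemma cinner_diff_left: "cinner (x - y) z = cinner x z - cinner y z"
  using cinner_add_left[of x "- y" z] by (simp add: cinner_minus_left)

lemma cinner_diff_right: "cinner x (y - z) = cinner x y - cinner x z"
  using cinner_add_right[of x y "- z"] by (simp add: cinner_minus_right)

lemma cinner_sum_left: "cinner (\<Sum>i\<in>A. f i) y = (\<Sum>i\<in>A. cinner (f i) y)"
  by (induction A rule: infinite_finite_induct) (simp_all add: cinner_add_left)

lemma cinner_self: "cinner x x = complex_of_real ((norm x)\<^sup>2)"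
proof -
  have "Im (cinner x x) = 0"
    using cinner_commute[of x x] by (metis cnj.simps(2) neg_equal_zero)
  then show ?thesis
    by (simp add: complex_eq_iff Re_cinner dot_square_norm)
qed

lemma cinner_ext_right: "(\<And>x. cinner x y = cinner x z) \<Longrightarrow> y = z"
  by (metis Re_cinner vector_eq_rdot inner_commute)

text \<open>With \<open>Re_cinner\<close> this recovers the Hermitian form from the real inner
  product.\<close>

lemma Im_cinner: "Im (cinner x y) = (- \<i>) *\<^sub>C x \<bullet> y"
  by (simp only: cinner_scaleC_left flip: Re_cinner) simp

lemma norm_scaleC: "norm (c *\<^sub>C x) = cmod c * norm (x :: 'h::chilbert_space)"
proof -
  have "complex_of_real ((norm (c *\<^sub>C x))\<^sup>2) = c * cnj c * complex_of_real ((norm x)\<^sup>2)"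
    by (simp only: flip: cinner_self) (simp add: cinner_scaleC_left cinner_scaleC_right)
  also have "\<dots> = complex_of_real ((cmod c * norm x)\<^sup>2)"
    by (simp add: complex_norm_square[symmetric] power_mult_distrib)
  finally have "(norm (c *\<^sub>C x))\<^sup>2 = (cmod c * norm x)\<^sup>2"
    using of_real_eq_iff by blast
  then show ?thesis by (simp add: power2_eq_iff_nonneg)
qed

text \<open>Near \<open>t = 0\<close> a nonzero linear term would outweigh the quadratic one and
  produce negative values. This first-variation argument serves the Riesz minimiser and
  \<open>psd_eq_zero\<close>.\<close>

lemma linear_term_zero:
  fixes a b :: real
  assumes "\<And>t. 2 * t * a + t\<^sup>2 * b \<ge> 0"
  shows "a = 0"
proof (rule ccontr)
  assume "a \<noteq> 0"
  \<comment> \<open>The step size makes \<open>s * b < 2\<close>, so that \<open>t = - s * a\<close>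
    gives the negative value \<open>a\<^sup>2 * s * (s * b - 2)\<close>.\<close>
  define s where "s = 1 / (1 + \<bar>b\<bar>)"
  have s: "s > 0" "s * b < 2"
    by (auto simp: s_def field_simps abs_if split: if_splits)
  have "2 * (- s * a) * a + (- s * a)\<^sup>2 * b = a\<^sup>2 * s * (s * b - 2)"
    by (simp add: power2_eq_square algebra_simps)
  also have "\<dots> < 0"
    using s \<open>a \<noteq> 0\<close> by (intro mult_pos_neg) auto
  finally show False using assms[of "- s * a"] by simp
qed

text \<open>The representing vector minimises \<open>\<lambda>x. x \<bullet> x - 2 * f x\<close>; the parallelogram law makes
  minimising sequences Cauchy.\<close>

lemma riesz_representation:
  fixes f :: "'a::{real_inner, complete_space} \<Rightarrow> real"
  assumes "bounded_linear f"
  shows "\<exists>r. \<forall>x. f x = x \<bullet> r"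
proof -
  interpret f: bounded_linear f by fact
  define F where "F x = x \<bullet> x - 2 * f x" for x
  obtain K where K: "\<And>x. norm (f x) \<le> norm x * K"
    using f.bounded by blast
  have lower: "F x \<ge> - K\<^sup>2" for x
  proof -
    have "f x \<le> norm x * K" using K[of x] by simp
    moreover have "0 \<le> (norm x - K)\<^sup>2" by simp
    ultimately show ?thesis
      unfolding F_def dot_square_norm power2_diff by simp
  qed
  then have bdd: "bdd_below (range F)" by (auto intro!: bdd_belowI)
  define d where "d = Inf (range F)"
  have d: "d \<le> F x" for x unfolding d_def by (rule cInf_lower) (auto intro: bdd)
  have "\<exists>x. F x < d + 1 / Suc n" for n
    using cInf_lessD[of "range F" "d + 1 / Suc n"] by (auto simp: d_def)
  then obtain u where u: "\<And>n. F (u n) < d + 1 / Suc n" by metis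
  \<comment> \<open>The linear terms cancel. As \<open>F\<close> is at least \<open>d\<close> at the
    midpoint, the squared distance of \<open>u m\<close> and \<open>u n\<close> is below
    \<open>2 / Suc m + 2 / Suc n\<close>.\<close>
  have par: "(norm (x - y))\<^sup>2 = 2 * F x + 2 * F y - 4 * F ((1/2) *\<^sub>R (x + y))" for x y
    by (simp add: F_def f.add f.scaleR power2_norm_eq_inner algebra_simps inner_commute)
  have "Cauchy u"
  proof (rule CauchyI)
    fix e :: real assume "e > 0"
    then obtain N where N: "4 / Suc N < e\<^sup>2"
      using reals_Archimedean[of "e\<^sup>2 / 4"] by (auto simp: field_simps)
    show "\<exists>M. \<forall>m\<ge>M. \<forall>n\<ge>M. norm (u m - u n) < e"
    proof (intro exI allI impI)
      fix m n assume mn: "m \<ge> N" "n \<ge> N"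
      have "1 / real (Suc m) \<le> 1 / Suc N" "1 / real (Suc n) \<le> 1 / Suc N"
        using mn by (simp_all add: frac_le)
      then have "(norm (u m - u n))\<^sup>2 < 4 / Suc N"
        using par[of "u m" "u n"] u[of m] u[of n] d[of "(1/2) *\<^sub>R (u m + u n)"]
        by simp
      then have "(norm (u m - u n))\<^sup>2 < e\<^sup>2" using N by simp
      then show "norm (u m - u n) < e" using \<open>e > 0\<close> by (simp add: power2_less_imp_less)
    qed
  qed
  then obtain r where r: "u \<longlonglongrightarrow> r" using Cauchy_convergent_iff convergentD by blast
  have "(\<lambda>n. F (u n)) \<longlonglongrightarrow> F r"
    unfolding F_def by (intro tendsto_intros r f.tendsto)
  moreover have "(\<lambda>n. d + 1 / Suc n) \<longlonglongrightarrow> d + 0"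
    using LIMSEQ_Suc[OF lim_1_over_n] by (intro tendsto_intros) simp
  ultimately have "F r \<le> d"
    using LIMSEQ_le[of "\<lambda>n. F (u n)" "F r" "\<lambda>n. d + 1 / Suc n" "d + 0"] u by (auto intro: less_imp_le)
  then have min: "F r \<le> F x" for x using d[of x] by simp
  \<comment> \<open>At the minimiser, the first-order change along \<open>r + t *\<^sub>R x\<close>
    vanishes.\<close>
  have "r \<bullet> x - f x = 0" for x
  proof (rule linear_term_zero)
    fix t
    show "0 \<le> 2 * t * (r \<bullet> x - f x) + t\<^sup>2 * (x \<bullet> x)"
      using min[of "r + t *\<^sub>R x"]
      by (simp add: F_def f.add f.scaleR algebra_simps power2_eq_square inner_commute)
  qed
  then show ?thesis by (metis eq_iff_diff_eq_0 inner_commute)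
qed

text \<open>The real identity at \<open>x\<close> gives the real parts; at
  \<open>(- \<i>) *\<^sub>C x\<close>, homogeneity of \<open>f\<close> turns it into the imaginary
  parts.\<close>

lemma cinner_eq_of_inner:
  assumes "\<And>x. f x \<bullet> y = x \<bullet> r" "\<And>c x. f (c *\<^sub>C x) = c *\<^sub>C f x"
  shows "cinner (f x) y = cinner x r"
  by (metis Im_cinner Re_cinner assms complex_eqI)

section \<open>Adjoints of bounded operators\<close>

lemma cadjoint_eqI:
  assumes "\<And>x y. cinner (S x) y = cinner x (R y)"
  shows "cadjoint S = R"
  unfolding cadjoint_def
proof (rule the_equality)
  show "\<forall>x y. cinner (S x) y = cinner x (R y)" using assms by blast
  show "R' = R" if "\<forall>x y. cinner (S x) y = cinner x (R' y)" for R'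
    using that assms by (intro ext cinner_ext_right) metis
qed

text \<open>Riesz represents the real functional \<open>\<lambda>x. S x \<bullet> y\<close>, and
  complex linearity of \<open>S\<close> lifts this to the Hermitian form. So the description in
  \<open>cadjoint\<close> denotes.\<close>

lemma cinner_cadjoint:
  assumes "bounded_clinear S"
  shows "cinner (S x) y = cinner x (cadjoint S y)"
proof -
  have "\<exists>r. \<forall>x. cinner (S x) y = cinner x r" for y
  proof -
    have "bounded_linear (\<lambda>x. S x \<bullet> y)"
      using assms bounded_linear_inner_left_comp unfolding bounded_clinear_def by blast
    then obtain r where "\<forall>x. S x \<bullet> y = x \<bullet> r" using riesz_representation by blast
    then show ?thesis
      using assms unfolding bounded_clinear_def by (intro exI allI cinner_eq_of_inner) auto
  qed
  then obtain R where R: "\<And>x y. cinner (S x) y = cinner x (R y)" by metis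
  then show ?thesis by (simp add: cadjoint_eqI[OF R])
qed

lemma cinner_cadjoint':
  "bounded_clinear S \<Longrightarrow> cinner y (S x) = cinner (cadjoint S y) x"
  by (metis cinner_cadjoint cinner_commute)

lemma clinear_cadjoint: "bounded_clinear S \<Longrightarrow> clinear (cadjoint S)"
  by (intro clinearI; rule cinner_ext_right)
    (simp_all add: cinner_add_right cinner_scaleC_right flip: cinner_cadjoint)

lemma cadjoint_comp:
  assumes "bounded_clinear S" "bounded_clinear R"
  shows "cadjoint (S \<circ> R) = cadjoint R \<circ> cadjoint S"
  by (intro cadjoint_eqI) (simp add: cinner_cadjoint assms)

lemma bounded_clinear_comp:
  "bounded_clinear S \<Longrightarrow> bounded_clinear R \<Longrightarrow> bounded_clinear (S \<circ> R)"
  unfolding bounded_clinear_def by (auto simp: comp_def intro: bounded_linear_compose)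

lemma bounded_clinear_funpow: "bounded_clinear S \<Longrightarrow> bounded_clinear (S ^^ k)"
proof (induction k)
  case 0
  then show ?case by (simp add: bounded_clinear_def id_def)
next
  case (Suc k)
  then show ?case using bounded_clinear_comp[of S "S ^^ k"] by (simp only: funpow.simps)
qed

lemma cadjoint_funpow:
  assumes "bounded_clinear S"
  shows "cadjoint (S ^^ k) = cadjoint S ^^ k"
proof (induction k)
  case 0
  show ?case by (rule cadjoint_eqI) simp
next
  case (Suc k)
  show ?case
    using cadjoint_comp[OF assms bounded_clinear_funpow[OF assms], of k] Suc
    by (metis funpow.simps(2) funpow_Suc_right)
qed

text \<open>Cauchy-Schwarz bounds the squared norm of \<open>cadjoint S x\<close> by a multiple of
  that norm. The constant is free because it is used with \<open>onorm S\<close>, with 1, and with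
  the bound on \<open>p(T)\<close>.\<close>

lemma norm_cadjoint_le:
  assumes "bounded_clinear S" "\<And>x. norm (S x) \<le> c * norm x"
  shows "norm (cadjoint S x) \<le> c * norm x"
proof (cases "cadjoint S x = 0")
  case True
  then show ?thesis using order_trans[OF norm_ge_zero assms(2)] by simp
next
  case False
  have "(norm (cadjoint S x))\<^sup>2 = S (cadjoint S x) \<bullet> x"
    by (metis Re_cinner cinner_cadjoint[OF assms(1)] dot_square_norm)
  also have "\<dots> \<le> norm (S (cadjoint S x)) * norm x" by (rule norm_cauchy_schwarz)
  also have "\<dots> \<le> c * norm (cadjoint S x) * norm x"
    by (intro mult_right_mono assms) auto
  finally show ?thesis using False by (simp add: power2_eq_square mult.assoc mult.left_commute)
qed

lemma cadjoint_cadjoint: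
  assumes "bounded_clinear S"
  shows "cadjoint (cadjoint S) = S"
  by (rule cadjoint_eqI) (metis cinner_cadjoint[OF assms] cinner_commute)

lemma bounded_clinear_cadjoint:
  assumes "bounded_clinear S"
  shows "bounded_clinear (cadjoint S)"
proof -
  interpret L: Vector_Spaces.linear scaleC scaleC "cadjoint S" using assms by (rule clinear_cadjoint)
  have "norm (cadjoint S x) \<le> norm x * onorm S" for x
    using norm_cadjoint_le[OF assms, of "onorm S" x] assms onorm
    unfolding bounded_clinear_def by (metis mult.commute)
  moreover have "cadjoint S (r *\<^sub>R x) = r *\<^sub>R cadjoint S x" for r x
    by (simp flip: scaleC_of_real add: L.scale)
  ultimately show ?thesis
    unfolding bounded_clinear_def
    by (intro conjI bounded_linear_intro[where K = "onorm S"]) (auto simp: L.add L.scale)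
qed

section \<open>Positive square roots\<close>

instance chilbert_space \<subseteq> banach ..

text \<open>Self-adjointness is built in and boundedness left out: the diagonalisation works with
  the algebra of a positive form alone.\<close>

definition psd :: "('h::chilbert_space \<Rightarrow> 'h) \<Rightarrow> bool" where
  "psd L \<longleftrightarrow> clinear L \<and> (\<forall>x y. cinner (L x) y = cinner x (L y)) \<and> (\<forall>x. 0 \<le> L x \<bullet> x)"

lemma psd_clinear: "psd L \<Longrightarrow> clinear L"
  and psd_selfadjoint: "psd L \<Longrightarrow> cinner (L x) y = cinner x (L y)"
  and psd_nonneg: "psd L \<Longrightarrow> 0 \<le> L x \<bullet> x"
  by (auto simp: psd_def)

lemma psd_cinner_real:
  assumes "psd L"
  shows "cinner (L x) x = complex_of_real (L x \<bullet> x)"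
proof -
  have "cnj (cinner (L x) x) = cinner (L x) x"
    using cinner_commute[of x "L x"] psd_selfadjoint[OF assms, of x x] by simp
  then have "Im (cinner (L x) x) = 0"
    by (metis cnj.simps(2) neg_equal_zero)
  then show ?thesis by (simp add: complex_eq_iff Re_cinner)
qed

lemma clinear_scaleR: "clinear L \<Longrightarrow> L (r *\<^sub>R x) = r *\<^sub>R L x"
  by (simp flip: scaleC_of_real add: clinear_scale)

text \<open>A substitute for Cauchy-Schwarz in the form of \<open>L\<close>: that form is
  nonnegative at \<open>x + t *\<^sub>R L x\<close> for all \<open>t\<close>, and its linear
  coefficient is twice the squared norm of \<open>L x\<close>.\<close>

lemma psd_eq_zero:
  assumes "psd L" "L x \<bullet> x = 0"
  shows "L x = 0"
proof -
  have "L x \<bullet> L x = 0"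
  proof (rule linear_term_zero)
    fix t
    have "L (L x) \<bullet> x = L x \<bullet> L x"
      by (metis Re_cinner assms(1) psd_selfadjoint)
    then show "0 \<le> 2 * t * (L x \<bullet> L x) + t\<^sup>2 * (L (L x) \<bullet> L x)"
      using psd_nonneg[OF assms(1), of "x + t *\<^sub>R L x"] assms(2) psd_clinear[OF assms(1)]
      by (simp add: clinear_add clinear_scaleR algebra_simps power2_eq_square)
  qed
  then show ?thesis by simp
qed

text \<open>Polarisation: the form is real at \<open>x\<close>, \<open>y\<close>,
  \<open>x + y\<close> and \<open>x + \<i> *\<^sub>C y\<close>, which makes it Hermitian.\<close>

lemma positive_operator_psd:
  assumes "positive_operator A"
  shows "psd A"
proof -
  have lin: "clinear A" using assms by (simp add: positive_operator_def bounded_clinear_imp_clinear)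
  have im: "Im (cinner (A x) x) = 0" and re: "0 \<le> Re (cinner (A x) x)" for x
    using assms by (auto simp: positive_operator_def complex_nonneg_Reals_iff)
  have "cinner (A x) y = cnj (cinner (A y) x)" for x y
  proof (rule complex_eqI)
    have "Im (cinner (A (x + y)) (x + y)) = 0" "Im (cinner (A (x + \<i> *\<^sub>C y)) (x + \<i> *\<^sub>C y)) = 0"
      by (rule im)+
    then show "Re (cinner (A x) y) = Re (cnj (cinner (A y) x))"
      "Im (cinner (A x) y) = Im (cnj (cinner (A y) x))"
      using im[of x] im[of y]
      by (simp_all add: clinear_add[OF lin] clinear_scale[OF lin] cinner_add_left cinner_add_right
          cinner_scaleC_left cinner_scaleC_right)
  qed
  then have "cinner (A x) y = cinner x (A y)" for x y
    by (metis cinner_commute)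
  then show ?thesis using lin re unfolding psd_def Re_cinner by blast
qed

lemma psd_positive_operator:
  assumes "psd A" "bounded_clinear A"
  shows "positive_operator A"
  unfolding positive_operator_def
  using assms psd_nonneg[OF assms(1)] by (simp add: psd_cinner_real)

text \<open>\<open>1 - L\<close> is the square root of \<open>1 - C\<close>. The scalar iteration with \<open>C = 1\<close> dominates the
  operator iteration \<open>Y \<mapsto> (C + Y\<^sup>2) / 2\<close>, which therefore converges in norm.\<close>

lemma half_square_iteration_limit:
  fixes C :: "'a::banach \<Rightarrow>\<^sub>L 'a"
  assumes "norm C \<le> 1"
  shows "\<exists>L. norm L \<le> 1 \<and> L = (1/2) *\<^sub>R (C + (L o\<^sub>L L)) \<and>
    (\<forall>Q. closed Q \<longrightarrow> 0 \<in> Q \<longrightarrow> (\<forall>Y\<in>Q. (1/2) *\<^sub>R (C + (Y o\<^sub>L Y)) \<in> Q) \<longrightarrow> L \<in> Q)"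
proof -
  define Y where "Y n = ((\<lambda>Y. (1/2) *\<^sub>R (C + (Y o\<^sub>L Y))) ^^ n) 0" for n
  define y where "y n = ((\<lambda>y. (1/2) * (1 + y * y)) ^^ n) (0::real)" for n
  have Y0: "Y 0 = 0" and YS: "Y (Suc n) = (1/2) *\<^sub>R (C + (Y n o\<^sub>L Y n))" for n
    by (simp_all add: Y_def)
  have y0: "y 0 = 0" and yS: "y (Suc n) = (1/2) * (1 + y n * y n)" for n
    by (simp_all add: y_def)
  have y: "0 \<le> y n \<and> y n \<le> 1" for n
  proof (induction n)
    case (Suc n)
    then have "y n * y n \<le> 1" by (simp add: mult_le_one)
    then show ?case by (simp add: yS)
  qed (simp add: y0)
  have Yy: "norm (Y n) \<le> y n" for n
  proof (induction n)
    case (Suc n)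
    have "norm (C + (Y n o\<^sub>L Y n)) \<le> norm C + norm (Y n) * norm (Y n)"
      using norm_triangle_ineq[of C "Y n o\<^sub>L Y n"] norm_blinfun_compose[of "Y n" "Y n"] by linarith
    also have "\<dots> \<le> 1 + y n * y n"
      using Suc assms y by (intro add_mono mult_mono) auto
    finally show ?case by (simp add: YS yS)
  qed (simp add: Y0 y0)
  have step: "norm (Y (Suc n) - Y n) \<le> y (Suc n) - y n" for n
  proof (induction n)
    case 0
    show ?case using assms by (simp add: Y0 y0 YS yS)
  next
    case (Suc n)
    \<comment> \<open>A difference of squares splits as Y' (Y' - Y) + (Y' - Y) Y even without
      commutation, so each increment is dominated by the scalar one.\<close>
    let ?D = "Y (Suc n) - Y n"
    have "Y (Suc (Suc n)) - Y (Suc n) =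
        (1/2) *\<^sub>R (C + (Y (Suc n) o\<^sub>L Y (Suc n))) - (1/2) *\<^sub>R (C + (Y n o\<^sub>L Y n))"
      by (rule arg_cong2[where f = minus, OF YS YS])
    also have "\<dots> = (1/2) *\<^sub>R ((Y (Suc n) o\<^sub>L ?D) + (?D o\<^sub>L Y n))"
      by (simp add: algebra_simps bounded_bilinear.diff_left[OF bounded_bilinear_blinfun_compose] bounded_bilinear.diff_right[OF bounded_bilinear_blinfun_compose])
    also have "norm \<dots> \<le> (1/2) * (norm (Y (Suc n)) * norm ?D + norm ?D * norm (Y n))"
      using norm_triangle_ineq[of "Y (Suc n) o\<^sub>L ?D" "?D o\<^sub>L Y n"]
        norm_blinfun_compose[of "Y (Suc n)" ?D] norm_blinfun_compose[of ?D "Y n"] by simp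
    also have "\<dots> \<le> (1/2) * (y (Suc n) * (y (Suc n) - y n) + (y (Suc n) - y n) * y n)"
      using Suc Yy y order_trans[OF norm_ge_zero Suc] by (intro mult_left_mono add_mono mult_mono) auto
    also have "\<dots> = (1/2) * (1 + y (Suc n) * y (Suc n)) - (1/2) * (1 + y n * y n)"
      by (simp add: algebra_simps)
    also have "\<dots> = y (Suc (Suc n)) - y (Suc n)"
      by (rule arg_cong2[where f = minus, OF yS[symmetric] yS[symmetric]])
    finally show ?case .
  qed
  have dist: "n \<le> m \<Longrightarrow> norm (Y m - Y n) \<le> y m - y n" for m n
  proof (induction rule: dec_induct)
    case (step m)
    then show ?case
      using \<open>\<And>n. norm (Y (Suc n) - Y n) \<le> y (Suc n) - y n\<close>[of m]
        norm_triangle_ineq[of "Y (Suc m) - Y m" "Y m - Y n"] by simp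
  qed simp
  have "incseq y" using order_trans[OF norm_ge_zero step] by (intro incseq_SucI) simp
  then have "Cauchy y"
    using y by (intro convergent_Cauchy Bseq_monoseq_convergent BseqI'[of _ 1] incseq_imp_monoseq) auto
  have "Cauchy Y"
  proof (rule CauchyI')
    fix e :: real assume "e > 0"
    then obtain M where M: "\<And>m n. m \<ge> M \<Longrightarrow> n \<ge> M \<Longrightarrow> norm (y m - y n) < e"
      using \<open>Cauchy y\<close> CauchyD by blast
    show "\<exists>M. \<forall>m\<ge>M. \<forall>n>m. dist (Y m) (Y n) < e"
    proof (intro exI[of _ M] allI impI)
      fix m n assume "m \<ge> M" "n > m"
      then show "dist (Y m) (Y n) < e"
        using dist[of m n] M[of n m] by (simp add: dist_norm norm_minus_commute)
    qed
  qed
  then obtain L where L: "Y \<longlonglongrightarrow> L" using Cauchy_convergent_iff convergentD by blast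
  have "(\<lambda>n. Y (Suc n)) \<longlonglongrightarrow> (1/2) *\<^sub>R (C + (L o\<^sub>L L))"
    unfolding YS by (intro tendsto_intros L bounded_bilinear.tendsto[OF bounded_bilinear_blinfun_compose])
  then have "L = (1/2) *\<^sub>R (C + (L o\<^sub>L L))"
    using L LIMSEQ_Suc LIMSEQ_unique by blast
  moreover have "norm L \<le> 1"
    using order_trans[OF Yy] y by (intro Lim_norm_ubound[OF _ L]) auto
  \<comment> \<open>All iterates lie in \<open>Q\<close>, hence so does the limit. Linearity,
    self-adjointness and commutation reach \<open>L\<close> in this way.\<close>
  moreover have "L \<in> Q" if "closed Q" "0 \<in> Q" "\<forall>Y\<in>Q. (1/2) *\<^sub>R (C + (Y o\<^sub>L Y)) \<in> Q" for Q
  proof -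
    have "Y n \<in> Q" for n by (induction n) (use that in \<open>auto simp: Y0 YS\<close>)
    then show ?thesis using closed_sequentially[OF that(1) _ L] by blast
  qed
  ultimately show ?thesis by blast
qed

section \<open>Existence and uniqueness of the positive square root\<close>

lemma bounded_clinear_blinfun_apply:
  "(\<And>c x. blinfun_apply L (c *\<^sub>C x) = c *\<^sub>C blinfun_apply L x) \<Longrightarrow> bounded_clinear (blinfun_apply L)"
  by (simp add: bounded_clinear_def blinfun.bounded_linear_right)

lemma bounded_clinear_id_minus:
  assumes "bounded_clinear S"
  shows "bounded_clinear (\<lambda>x. x - S x)"
proof -
  have "c *\<^sub>C x - c *\<^sub>C y = c *\<^sub>C (x - y)" for c and x y :: 'a
    by (simp add: complex_vector.scale_right_diff_distrib)
  then show ?thesis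
    using assms unfolding bounded_clinear_def
    by (auto intro: bounded_linear_sub bounded_linear_ident)
qed

lemma bounded_linear_scaleC: "bounded_linear (\<lambda>x. c *\<^sub>C (x :: 'h::chilbert_space))"
proof (rule bounded_linear_intro[where K = "cmod c"])
  show "c *\<^sub>C r *\<^sub>R x = r *\<^sub>R c *\<^sub>C x" for r and x :: 'h
    by (simp flip: scaleC_of_real add: scaleC_scaleC mult.commute)
qed (simp_all add: scaleC_add_right norm_scaleC)

lemma bounded_linear_cinner_left: "bounded_linear (\<lambda>x. cinner x y)"
proof -
  have "bounded_linear (\<lambda>x. complex_of_real (x \<bullet> y) + \<i> * complex_of_real (((- \<i>) *\<^sub>C x) \<bullet> y))"
    by (intro bounded_linear_add bounded_linear_const_mult bounded_linear_of_real[THEN bounded_linear_compose]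
        bounded_linear_inner_left_comp bounded_linear_scaleC bounded_linear_ident)
  moreover have "complex_of_real (x \<bullet> y) + \<i> * complex_of_real (((- \<i>) *\<^sub>C x) \<bullet> y) = cinner x y" for x
    by (simp add: complex_eq_iff Re_cinner Im_cinner)
  ultimately show ?thesis by simp
qed

lemma continuous_on_cinner [continuous_intros]:
  assumes "continuous_on A f"
  shows "continuous_on A (\<lambda>x. cinner (f x) y)" "continuous_on A (\<lambda>x. cinner y (f x))"
proof -
  show *: "continuous_on A (\<lambda>x. cinner (f x) y)"
    by (rule bounded_linear.continuous_on[OF bounded_linear_cinner_left assms])
  show "continuous_on A (\<lambda>x. cinner y (f x))"
    by (subst cinner_commute) (intro continuous_on_cnj *)
qed

text \<open>With \<open>L\<close> the limit of the iteration, the fixed-point equation says that the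
  square of \<open>1 - L\<close> is \<open>1 - C\<close>. The clause on closed sets is applied to
  complex linearity, to self-adjointness and to commutation with \<open>B\<close>; the last is what
  uniqueness of the root rests on.\<close>

lemma sqrt_one_minus:
  fixes C :: "'h::chilbert_space \<Rightarrow> 'h"
  assumes C: "bounded_clinear C" "\<And>x. norm (C x) \<le> norm x" "\<And>x y. cinner (C x) y = cinner x (C y)"
  shows "\<exists>X. positive_operator X \<and> X \<circ> X = (\<lambda>x. x - C x) \<and>
     (\<forall>B. bounded_linear B \<longrightarrow> (\<forall>x. B (C x) = C (B x)) \<longrightarrow> (\<forall>x. B (X x) = X (B x)))"
proof -
  have blin: "bounded_linear C" using C(1) by (simp add: bounded_clinear_def)
  define C' where "C' = Blinfun C"
  have C': "blinfun_apply C' = C" by (simp add: C'_def bounded_linear_Blinfun_apply blin)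
  have "norm C' \<le> 1" by (rule norm_blinfun_bound) (simp_all add: C' C)
  from half_square_iteration_limit[OF this] obtain L where
    L1: "norm L \<le> 1" and L: "L = (1/2) *\<^sub>R (C' + (L o\<^sub>L L))" and
    inv: "\<forall>Q. closed Q \<longrightarrow> 0 \<in> Q \<longrightarrow> (\<forall>Y\<in>Q. (1/2) *\<^sub>R (C' + (Y o\<^sub>L Y)) \<in> Q) \<longrightarrow> L \<in> Q"
    by (elim exE conjE)
  note Q = inv[rule_format]
  have app: "blinfun_apply ((1/2) *\<^sub>R (C' + (Y o\<^sub>L Y))) x = (1/2) *\<^sub>R (C x + Y (Y x))" for Y x
    by (simp add: blinfun.scaleR_left blinfun.add_left C')
  have scaleR_scaleC: "c *\<^sub>C r *\<^sub>R x = r *\<^sub>R c *\<^sub>C x" for r c and x :: 'h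
    by (simp flip: scaleC_of_real add: scaleC_scaleC mult.commute)
  have "L \<in> {Y :: 'h \<Rightarrow>\<^sub>L 'h. \<forall>c x. Y (c *\<^sub>C x) = c *\<^sub>C Y x}"
  proof (rule Q)
    show "closed {Y::'h \<Rightarrow>\<^sub>L 'h. \<forall>c x. Y (c *\<^sub>C x) = c *\<^sub>C Y x}"
      by (intro closed_Collect_all closed_Collect_eq continuous_intros
          bounded_linear.continuous_on[OF bounded_linear_scaleC])
  qed (use C(1) in \<open>auto simp: app bounded_clinear_def scaleR_scaleC scaleC_add_right\<close>)
  then have bL: "bounded_clinear (blinfun_apply L)" by (intro bounded_clinear_blinfun_apply) auto
  have scR: "cinner (r *\<^sub>R x) y = r * cinner x y" "cinner x (r *\<^sub>R y) = r * cinner x y" for r and x y :: 'h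
    by (simp_all flip: scaleC_of_real add: cinner_scaleC_left cinner_scaleC_right)
  have "L \<in> {Y :: 'h \<Rightarrow>\<^sub>L 'h. \<forall>x y. cinner (Y x) y = cinner x (Y y)}"
  proof (rule Q)
    show "closed {Y::'h \<Rightarrow>\<^sub>L 'h. \<forall>x y. cinner (Y x) y = cinner x (Y y)}"
      by (intro closed_Collect_all closed_Collect_eq continuous_intros)
  qed (auto simp: app scR cinner_add_left cinner_add_right C(3))
  then have sL: "cinner (L x) y = cinner x (L y)" for x y by auto
  have com: "B (L x) = L (B x)" if B: "bounded_linear B" "\<And>x. B (C x) = C (B x)" for B x
  proof -
    interpret B: bounded_linear B by fact
    have "L \<in> {Y :: 'h \<Rightarrow>\<^sub>L 'h. \<forall>x. B (Y x) = Y (B x)}"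
    proof (rule Q)
      show "closed {Y::'h \<Rightarrow>\<^sub>L 'h. \<forall>x. B (Y x) = Y (B x)}"
        by (intro closed_Collect_all closed_Collect_eq continuous_intros B.continuous_on)
    qed (auto simp: app B.scaleR B.add B.zero B(2))
    then show ?thesis by auto
  qed
  define X where "X x = x - L x" for x
  have "bounded_clinear X" unfolding X_def by (rule bounded_clinear_id_minus[OF bL])
  moreover have "psd X"
    unfolding psd_def
  proof (intro conjI allI)
    show "clinear X" using calculation by (rule bounded_clinear_imp_clinear)
    show "cinner (X x) y = cinner x (X y)" for x y
      by (simp add: X_def cinner_diff_left cinner_diff_right sL)
    show "0 \<le> X x \<bullet> x" for x
    proof -
      have "L x \<bullet> x \<le> norm (L x) * norm x" by (rule norm_cauchy_schwarz)
      also have "\<dots> \<le> (norm L * norm x) * norm x"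
        by (intro mult_right_mono norm_blinfun) auto
      also have "\<dots> \<le> (1 * norm x) * norm x"
        using L1 by (intro mult_right_mono) auto
      finally show ?thesis by (simp add: X_def inner_diff_left flip: power2_norm_eq_inner power2_eq_square)
    qed
  qed
  ultimately have "positive_operator X" by (intro psd_positive_operator)
  moreover have "X (X x) = x - C x" for x
  proof -
    have "L x = (1/2) *\<^sub>R (C x + L (L x))" using L app by metis
    from arg_cong[OF this, of "scaleR 2"] have "2 *\<^sub>R L x = C x + L (L x)" by simp
    then have "C x = L x + L x - L (L x)" by (simp add: algebra_simps scaleR_2)
    then show ?thesis by (simp add: X_def blinfun.diff_right)
  qed
  moreover have "B (X x) = X (B x)" if "bounded_linear B" "\<forall>x. B (C x) = C (B x)" for B x
    using com[of B x] that by (simp add: X_def bounded_linear.linear linear_diff)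
  ultimately show ?thesis by (intro exI[of _ X]) auto
qed

text \<open>For E = B - X, commutation gives (B + X) E = 0. The forms of B and X at
  \<open>E x\<close> are nonnegative with sum 0, so both operators kill \<open>E x\<close>. Hence E
  E = 0, and E = 0 by self-adjointness.\<close>

lemma positive_sqrt_unique:
  assumes X: "psd X" and B: "psd B" and sq: "X \<circ> X = B \<circ> B" and com: "\<And>x. B (X x) = X (B x)"
  shows "B = X"
proof
  fix x
  define E where "E x = B x - X x" for x
  have sE: "cinner (E x) y = cinner x (E y)" for x y
    using X B by (simp add: E_def cinner_diff_left cinner_diff_right psd_selfadjoint)
  have EE: "E (E x) = 0" for x
  proof -
    have "B (E x) + X (E x) = 0"
      using fun_cong[OF sq, of x]
      by (simp add: E_def clinear_diff[OF psd_clinear[OF X]] clinear_diff[OF psd_clinear[OF B]] com)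
    then have "B (E x) \<bullet> E x + X (E x) \<bullet> E x = 0" by (metis inner_add_left inner_zero_left)
    then have "B (E x) \<bullet> E x = 0" "X (E x) \<bullet> E x = 0"
      using psd_nonneg[OF X, of "E x"] psd_nonneg[OF B, of "E x"] by linarith+
    then have "B (E x) = 0" "X (E x) = 0" using psd_eq_zero X B by auto
    then show ?thesis unfolding E_def[of "E x"] by simp
  qed
  have "cinner (E x) (E x) = 0" by (simp add: sE EE)
  then have "E x = 0" by (simp add: cinner_self)
  then show "B x = X x" by (simp add: E_def)
qed

text \<open>A positive root \<open>B\<close> commutes with its own square, hence with
  \<open>C\<close>, hence with the root constructed by iteration; so the two agree and
  \<open>operator_sqrt\<close> denotes.\<close>

lemma positive_operator_sqrt:
  assumes "bounded_clinear C" "\<And>x. norm (C x) \<le> norm x" "\<And>x y. cinner (C x) y = cinner x (C y)"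
  shows "positive_operator (operator_sqrt (\<lambda>x. x - C x))"
    and "operator_sqrt (\<lambda>x. x - C x) \<circ> operator_sqrt (\<lambda>x. x - C x) = (\<lambda>x. x - C x)"
proof -
  from sqrt_one_minus[OF assms] obtain X where X: "positive_operator X" "X \<circ> X = (\<lambda>x. x - C x)"
    and com: "\<And>B x. bounded_linear B \<Longrightarrow> (\<forall>x. B (C x) = C (B x)) \<Longrightarrow> B (X x) = X (B x)"
    by blast
  have uniq: "B = X" if B: "positive_operator B" "B \<circ> B = (\<lambda>x. x - C x)" for B
  proof (rule positive_sqrt_unique)
    have lin: "bounded_linear B" using B(1) by (simp add: positive_operator_def bounded_clinear_def)
    have *: "B (B y) = y - C y" for y using fun_cong[OF B(2)] by simp
    have "B (C y) = C (B y)" for y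
      using *[of "B y"] *[of y] lin by (simp add: bounded_linear.linear linear_diff)
    then show "B (X x) = X (B x)" for x by (intro com lin) auto
  qed (use X B in \<open>auto simp: positive_operator_psd\<close>)
  then have "operator_sqrt (\<lambda>x. x - C x) = X"
    unfolding operator_sqrt_def by (intro the_equality conjI X) (elim conjE, rule uniq)
  then show "positive_operator (operator_sqrt (\<lambda>x. x - C x))"
    "operator_sqrt (\<lambda>x. x - C x) \<circ> operator_sqrt (\<lambda>x. x - C x) = (\<lambda>x. x - C x)"
    using X by simp_all
qed

section \<open>Diagonalising a finite-rank defect\<close>

text \<open>More than \<open>card B\<close> vectors of the span satisfy a linear relation. It is
  recorded as a polynomial so that it can be factored over the complex numbers.\<close>

lemma dependent_sequence:
  fixes v :: "nat \<Rightarrow> 'h::chilbert_space"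
  assumes "finite B" "\<And>k. v k \<in> cspan B"
  shows "\<exists>q :: complex poly. q \<noteq> 0 \<and> (\<Sum>k\<le>degree q. coeff q k *\<^sub>C v k) = 0"
proof -
  define N where "N = card B"
  have "\<exists>c :: nat \<Rightarrow> complex. (\<exists>k\<le>N. c k \<noteq> 0) \<and> (\<Sum>k\<le>N. c k *\<^sub>C v k) = 0"
  proof (cases "inj_on v {..N}")
    case True
    have "complex_vector.dependent (v ` {..N})"
    proof (rule ccontr)
      assume "complex_vector.independent (v ` {..N})"
      then have "card (v ` {..N}) \<le> card B"
        using complex_vector.independent_span_bound[OF assms(1)] assms(2) by blast
      then show False using True by (simp add: card_image N_def)
    qed
    then obtain u where u: "\<exists>w\<in>v ` {..N}. u w \<noteq> 0" "(\<Sum>w\<in>v ` {..N}. u w *\<^sub>C w) = 0"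
      by (subst (asm) complex_vector.dependent_finite) auto
    then show ?thesis using True by (intro exI[of _ "u \<circ> v"]) (auto simp: sum.reindex)
  next
    case False
    then obtain i j where ij: "i \<le> N" "j \<le> N" "i \<noteq> j" "v i = v j" by (auto simp: inj_on_def)
    \<comment> \<open>A repeated vector gives the relation \<open>v i - v j = 0\<close>.\<close>
    define c :: "nat \<Rightarrow> complex" where "c k = (if k = i then 1 else 0) + (if k = j then - 1 else 0)" for k
    have "(\<Sum>k\<le>N. c k *\<^sub>C v k) =
        (\<Sum>k\<le>N. if k = i then v k else 0) + (\<Sum>k\<le>N. if k = j then - v k else 0)"
      using ij(3) unfolding sum.distrib[symmetric]
      by (intro sum.cong) (auto simp: c_def scaleC_one)
    also have "\<dots> = 0" using ij by simp
    finally show ?thesis using ij by (intro exI[of _ c]) (auto simp: c_def)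
  qed
  then obtain c :: "nat \<Rightarrow> complex" and k where c: "k \<le> N" "c k \<noteq> 0" "(\<Sum>k\<le>N. c k *\<^sub>C v k) = 0"
    by blast
  define q where "q = (\<Sum>k\<le>N. monom (c k) k)"
  have coeff_q: "coeff q j = (if j \<le> N then c j else 0)" for j
    by (simp add: q_def coeff_sum coeff_monom)
  have "degree q \<le> N" by (rule degree_le) (simp add: coeff_q)
  then have "(\<Sum>k\<le>degree q. coeff q k *\<^sub>C v k) = (\<Sum>k\<le>N. coeff q k *\<^sub>C v k)"
    by (intro sum.mono_neutral_left) (auto simp: coeff_eq_0)
  also have "\<dots> = 0" using c(3) by (simp add: coeff_q)
  finally show ?thesis using c by (intro exI[of _ q]) (metis coeff_0 coeff_q)
qed

context
  fixes L :: "'h::chilbert_space \<Rightarrow> 'h"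
  assumes L: "clinear L"
begin

text \<open>Let \<open>a\<close> be a root of \<open>q\<close>. Either \<open>L\<close> kills
  \<open>S g - a *\<^sub>C g\<close>, and \<open>g\<close> is the eigenvector, or this vector
  replaces \<open>g\<close> and satisfies the relation given by the quotient of \<open>q\<close>, of
  smaller degree. A nonzero constant \<open>q\<close> would force \<open>L g = 0\<close>.\<close>

lemma eigenvector_mod_kernel_of_poly:
  assumes S: "clinear S" and K: "\<And>x. L x = 0 \<Longrightarrow> L (S x) = 0"
    and G: "complex_vector.subspace G" "\<And>x. x \<in> G \<Longrightarrow> S x \<in> G"
    and "q \<noteq> 0" "g \<in> G" "L g \<noteq> 0" "(\<Sum>k\<le>degree q. coeff q k *\<^sub>C L ((S ^^ k) g)) = 0"
  shows "\<exists>g\<in>G. \<exists>a. L g \<noteq> 0 \<and> L (S g) = a *\<^sub>C L g"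
  using assms(5-)
proof (induction "degree q" arbitrary: q g)
  case 0
  then show ?case
    by (metis (no_types, lifting) atMost_0 coeff_0 complex_vector.scale_eq_0_iff finite.emptyI empty_iff
        funpow_0 leading_coeff_0_iff sum.insert sum.empty add.right_neutral)
next
  case (Suc n)
  have "\<not> constant (poly q)" using Suc.hyps(2) by (simp add: constant_degree)
  then obtain a where "poly q a = 0" using fundamental_theorem_of_algebra by blast
  then obtain r where r: "q = [:- a, 1:] * r" by (meson dvdE poly_eq_0_iff_dvd)
  have "r \<noteq> 0" using r Suc.prems(1) by auto
  then have deg: "degree q = Suc (degree r)" unfolding r by (subst degree_mult_eq) auto
  define g' where "g' = S g - a *\<^sub>C g"
  show ?case
  proof (cases "L g' = 0")
    case True
    then have "L (S g) = a *\<^sub>C L g" by (simp add: g'_def clinear_diff[OF L] clinear_scale[OF L])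
    then show ?thesis using Suc.prems by blast
  next
    case False
    have g': "g' \<in> G" unfolding g'_def
      using G Suc.prems by (intro complex_vector.subspace_diff complex_vector.subspace_scale) auto
    let ?v = "\<lambda>k. L ((S ^^ k) g)"
    have step: "L ((S ^^ k) g') = ?v (Suc k) - a *\<^sub>C ?v k" for k
      using clinear_funpow[OF S, of k]
      by (simp add: g'_def clinear_diff[OF L] clinear_scale[OF L] clinear_diff clinear_scale funpow_swap1)
    have cq: "coeff q k = (case k of 0 \<Rightarrow> 0 | Suc j \<Rightarrow> coeff r j) - a * coeff r k" for k
      by (simp add: r coeff_pCons split: nat.splits)
    \<comment> \<open>Since \<open>q = [:- a, 1:] * r\<close>, the relation for \<open>q\<close> at
      \<open>g\<close> is the relation for \<open>r\<close> at \<open>g'\<close>.\<close>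
    have "(\<Sum>k\<le>degree q. coeff q k *\<^sub>C ?v k) =
      (\<Sum>k\<le>degree q. (case k of 0 \<Rightarrow> 0 | Suc j \<Rightarrow> coeff r j) *\<^sub>C ?v k) - (\<Sum>k\<le>degree q. (a * coeff r k) *\<^sub>C ?v k)"
      by (simp only: cq complex_vector.scale_left_diff_distrib sum_subtractf)
    also have "(\<Sum>k\<le>degree q. (case k of 0 \<Rightarrow> 0 | Suc j \<Rightarrow> coeff r j) *\<^sub>C ?v k) =
        (\<Sum>k\<le>degree r. coeff r k *\<^sub>C ?v (Suc k))"
      unfolding deg by (subst sum.atMost_Suc_shift) simp
    also have "(\<Sum>k\<le>degree q. (a * coeff r k) *\<^sub>C ?v k) = (\<Sum>k\<le>degree r. coeff r k *\<^sub>C a *\<^sub>C ?v k)"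
      unfolding deg by (simp add: coeff_eq_0 scaleC_scaleC mult.commute)
    finally have "(\<Sum>k\<le>degree r. coeff r k *\<^sub>C L ((S ^^ k) g')) = 0"
      using Suc.prems(4)
      by (simp only: step complex_vector.scale_right_diff_distrib sum_subtractf)
    then show ?thesis using Suc.hyps(1)[of r g'] deg Suc.hyps(2) \<open>r \<noteq> 0\<close> g' False by simp
  qed
qed

text \<open>The \<open>S j\<close> act on the quotient by the kernel of \<open>L\<close>, which is
  finite-dimensional like the range of \<open>L\<close>, and commuting operators there have a joint
  eigenvector. In the induction \<open>G\<close> is the preimage of the joint eigenspace found so
  far; commutation makes it invariant under the next operator.\<close>

lemma common_eigenvector_mod_kernel:
  fixes S :: "'i \<Rightarrow> 'h \<Rightarrow> 'h"
  assumes B: "finite B" "range L \<subseteq> cspan B" and nz: "L h \<noteq> 0" and J: "finite J"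
    and S: "\<And>j. j \<in> J \<Longrightarrow> clinear (S j)" "\<And>j x. j \<in> J \<Longrightarrow> L x = 0 \<Longrightarrow> L (S j x) = 0"
      "\<And>i j x. i \<in> J \<Longrightarrow> j \<in> J \<Longrightarrow> S i (S j x) = S j (S i x)"
  shows "\<exists>g \<mu>. L g \<noteq> 0 \<and> (\<forall>j\<in>J. L (S j g) = \<mu> j *\<^sub>C L g)"
  using J S
proof (induction J)
  case empty
  then show ?case using nz by auto
next
  case (insert j J)
  have "\<exists>g \<mu>. L g \<noteq> 0 \<and> (\<forall>j\<in>J. L (S j g) = \<mu> j *\<^sub>C L g)"
    by (rule insert.IH) (use insert.prems in auto)
  then obtain g \<mu> where g: "L g \<noteq> 0" "\<And>i. i \<in> J \<Longrightarrow> L (S i g) = \<mu> i *\<^sub>C L g"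
    by blast
  define G where "G = {x. \<forall>i\<in>J. L (S i x) = \<mu> i *\<^sub>C L x}"
  have lin: "clinear (S i)" if "i \<in> insert j J" for i using insert.prems(1) that by blast
  have "complex_vector.subspace G"
    unfolding G_def complex_vector.subspace_def
    using lin by (auto simp: clinear_zero[OF L] clinear_add[OF L] clinear_scale[OF L] clinear_zero
        clinear_add clinear_scale scaleC_add_right scaleC_scaleC mult.commute)
  moreover have "S j x \<in> G" if x: "x \<in> G" for x
  proof -
    have "L (S i (S j x)) = \<mu> i *\<^sub>C L (S j x)" if i: "i \<in> J" for i
    proof -
      have "L (S i x - \<mu> i *\<^sub>C x) = 0"
        using x i by (simp add: G_def clinear_diff[OF L] clinear_scale[OF L])
      then have "L (S j (S i x - \<mu> i *\<^sub>C x)) = 0" by (intro insert.prems(2)) auto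
      then show ?thesis
        using insert.prems(3)[of i j x] i
        by (simp add: clinear_diff[OF L] clinear_scale[OF L] clinear_diff[OF lin] clinear_scale[OF lin])
    qed
    then show ?thesis by (simp add: G_def)
  qed
  moreover have "\<exists>q :: complex poly. q \<noteq> 0 \<and> (\<Sum>k\<le>degree q. coeff q k *\<^sub>C L ((S j ^^ k) g)) = 0"
    by (rule dependent_sequence[OF B(1)]) (use B(2) in auto)
  then obtain q :: "complex poly" where "q \<noteq> 0" "(\<Sum>k\<le>degree q. coeff q k *\<^sub>C L ((S j ^^ k) g)) = 0"
    by blast
  moreover have "g \<in> G" using g by (simp add: G_def)
  ultimately obtain g' a where g': "g' \<in> G" "L g' \<noteq> 0" "L (S j g') = a *\<^sub>C L g'"
    using eigenvector_mod_kernel_of_poly[OF lin[of j], of G q g] insert.prems(2)[of j] g(1) by blast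
  then show ?case
    using insert.hyps by (intro exI[of _ g'] exI[of _ "\<mu>(j := a)"]) (auto simp: G_def)
qed

end

text \<open>Some \<open>b\<close> in \<open>B\<close> is not orthogonal to \<open>g\<close>. The
  projection along \<open>b\<close> onto the orthogonal complement of \<open>g\<close> kills
  \<open>b\<close> and fixes that complement, so the images of the other generators suffice.\<close>

lemma cspan_kernel_smaller:
  assumes B: "finite B" and f: "f \<in> cspan B" "cinner f g \<noteq> 0"
  shows "\<exists>B'. finite B' \<and> card B' < card B \<and> {x \<in> cspan B. cinner x g = 0} \<subseteq> cspan B'"
proof -
  have "\<exists>b\<in>B. cinner b g \<noteq> 0"
  proof (rule ccontr)
    assume "\<not> ?thesis"
    then have "cspan B \<subseteq> {x. cinner x g = 0}"
      by (intro complex_vector.span_minimal)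
        (auto simp: complex_vector.subspace_def cinner_add_left cinner_scaleC_left)
    then show False using f by blast
  qed
  then obtain b where b: "b \<in> B" "cinner b g \<noteq> 0" by blast
  define \<pi> where "\<pi> x = x - (cinner x g / cinner b g) *\<^sub>C b" for x
  have "clinear \<pi>"
    by (intro clinearI) (simp_all add: \<pi>_def cinner_add_left cinner_scaleC_left add_divide_distrib
        scaleC_add_left complex_vector.scale_right_diff_distrib scaleC_scaleC)
  define B' where "B' = \<pi> ` (B - {b})"
  have "x \<in> cspan B \<Longrightarrow> \<pi> x \<in> cspan B'" for x
  proof (induction rule: complex_vector.span_induct_alt)
    case base
    show ?case by (simp add: clinear_zero[OF \<open>clinear \<pi>\<close>] complex_vector.span_zero)
  next
    case (step c y z)
    have "\<pi> y \<in> cspan B'"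
    proof (cases "y = b")
      case True
      then have "\<pi> y = 0" using b by (simp add: \<pi>_def scaleC_one)
      then show ?thesis by (simp add: complex_vector.span_zero)
    next
      case False
      then show ?thesis using step by (intro complex_vector.span_base) (auto simp: B'_def)
    qed
    then show ?case using step
      by (simp add: clinear_add[OF \<open>clinear \<pi>\<close>] clinear_scale[OF \<open>clinear \<pi>\<close>]
          complex_vector.span_add complex_vector.span_scale)
  qed
  then have "{x \<in> cspan B. cinner x g = 0} \<subseteq> cspan B'"
    by (force simp: \<pi>_def)
  moreover have "card B' < card B"
    using card_image_le[of "B - {b}" \<pi>] B b
    unfolding B'_def by (meson card_Diff1_less finite_Diff le_less_trans)
  ultimately show ?thesis using B by (intro exI[of _ B']) (auto simp: B'_def)
qed

text \<open>The adjoints of the \<open>T j\<close> are isometric for the form induced by \<open>L\<close>, so their joint eigenvalues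
  \<open>\<mu> j\<close> modulo its kernel are unimodular; if \<open>g\<close> is such an eigenvector, then \<open>L g\<close> is one of each \<open>T j\<close>.\<close>

lemma psd_invariant_decomposition:
  fixes L :: "'h::chilbert_space \<Rightarrow> 'h" and T :: "'i \<Rightarrow> 'h \<Rightarrow> 'h"
  assumes "finite B" "range L \<subseteq> cspan B" "psd L" "finite J"
    and "\<And>j. j \<in> J \<Longrightarrow> bounded_clinear (T j)"
    and "\<And>i j x. i \<in> J \<Longrightarrow> j \<in> J \<Longrightarrow> T i (T j x) = T j (T i x)"
    and "\<And>j x. j \<in> J \<Longrightarrow> T j (L (cadjoint (T j) x)) = L x"
  shows "\<exists>F. (\<forall>(f, \<nu>) \<in> set F. \<forall>j\<in>J. T j f = \<nu> j *\<^sub>C f \<and> cmod (\<nu> j) = 1) \<and>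
    (\<forall>h. L h \<bullet> h = (\<Sum>(f, \<nu>) \<leftarrow> F. (cmod (cinner h f))\<^sup>2))"
  using assms
proof (induction "card B" arbitrary: B L rule: less_induct)
  case less
  note L = psd_clinear[OF \<open>psd L\<close>] and T = less.prems(5) and inv = less.prems(7)
  define S where "S j = cadjoint (T j)" for j
  have S: "clinear (S j)" if "j \<in> J" for j using T[OF that] by (simp add: S_def clinear_cadjoint)
  have adj: "cinner (T j x) y = cinner x (S j y)" if "j \<in> J" for j x y
    using T[OF that] by (simp add: S_def cinner_cadjoint)
  show ?case
  proof (cases "\<exists>h. L h \<noteq> 0")
    case False
    then show ?thesis by (intro exI[of _ "[]"]) auto
  next
    case True
    then obtain h where h: "L h \<noteq> 0" by blast
    have form: "cinner (L (S j x)) (S j y) = cinner (L x) y" if "j \<in> J" for j x y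
      using inv[OF that] by (metis S_def adj that)
    have ker: "L (S j x) = 0" if "j \<in> J" "L x = 0" for j x
    proof (rule psd_eq_zero[OF \<open>psd L\<close>])
      show "L (S j x) \<bullet> S j x = 0" using form[OF that(1), of x x] that(2) by (simp flip: Re_cinner)
    qed
    have com: "S i (S j x) = S j (S i x)" if "i \<in> J" "j \<in> J" for i j x
      by (rule cinner_ext_right) (metis adj less.prems(6) that)
    obtain g \<mu> where g: "L g \<noteq> 0" "\<And>j. j \<in> J \<Longrightarrow> L (S j g) = \<mu> j *\<^sub>C L g"
      using common_eigenvector_mod_kernel[OF L less.prems(1,2) h less.prems(4), of S] S ker com by blast
    define r where "r = L g \<bullet> g"
    have r: "r > 0" using psd_eq_zero[OF \<open>psd L\<close>] psd_nonneg[OF \<open>psd L\<close>, of g] g(1)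
      by (force simp: r_def less_le)
    have rg: "cinner (L g) g = r" "cinner g (L g) = r"
      using psd_cinner_real[OF \<open>psd L\<close>, of g] psd_selfadjoint[OF \<open>psd L\<close>, of g g] by (simp_all add: r_def)
    have \<mu>: "cmod (\<mu> j) = 1" if "j \<in> J" for j
    proof -
      have "complex_of_real r = cinner (L (S j g)) (S j g)" using form[OF that, of g g] rg by simp
      also have "\<dots> = \<mu> j * cinner g (L (S j g))"
        using g(2)[OF that] by (simp add: cinner_scaleC_left psd_selfadjoint[OF \<open>psd L\<close>])
      also have "\<dots> = complex_of_real ((cmod (\<mu> j))\<^sup>2) * r"
        using g(2)[OF that] by (simp add: cinner_scaleC_right rg complex_norm_square del: of_real_power)
      finally have "r = (cmod (\<mu> j))\<^sup>2 * r" by (simp only: of_real_eq_iff flip: of_real_mult)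
      then show ?thesis using r by (simp add: power2_eq_1_iff) (metis norm_ge_zero not_one_le_zero neg_0_le_iff_le)
    qed
    \<comment> \<open>Normalised so that the rank-one operator
      \<open>\<lambda>x. cinner x f *\<^sub>C f\<close> agrees with \<open>L\<close> at
      \<open>g\<close>.\<close>
    define f where "f = complex_of_real (1 / sqrt r) *\<^sub>C L g"
    define \<nu> where "\<nu> j = cnj (\<mu> j)" for j
    have Tf: "T j f = \<nu> j *\<^sub>C f" if "j \<in> J" for j
    proof -
      have lin: "clinear (T j)" using T[OF that] by (rule bounded_clinear_imp_clinear)
      have "L g = \<mu> j *\<^sub>C T j (L g)"
        using inv[OF that, of g] g(2)[OF that] by (simp add: S_def clinear_scale[OF lin])
      then have "cnj (\<mu> j) *\<^sub>C L g = (cnj (\<mu> j) * \<mu> j) *\<^sub>C T j (L g)" by (metis scaleC_scaleC)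
      also have "cnj (\<mu> j) * \<mu> j = 1"
        using \<mu>[OF that] complex_norm_square[of "\<mu> j"] by (simp add: mult.commute)
      finally have "T j (L g) = cnj (\<mu> j) *\<^sub>C L g" by (simp add: scaleC_one)
      then show ?thesis
        by (simp add: f_def \<nu>_def clinear_scale[OF lin] scaleC_scaleC mult.commute)
    qed
    define L' where "L' x = L x - cinner x f *\<^sub>C f" for x
    \<comment> \<open>Subtracting the rank-one part amounts to removing from \<open>x\<close> its
      component along \<open>g\<close>, orthogonally for the form of \<open>L\<close>, before
      applying \<open>L\<close>. Hence \<open>L'\<close> stays positive with range in
      \<open>cspan B\<close>.\<close>
    have L'_alt: "L' x = L (x - (cinner x (L g) / r) *\<^sub>C g)" for x
    proof -
      have "complex_of_real (1 / sqrt r) * complex_of_real (1 / sqrt r) = 1 / complex_of_real r"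
        using r by (simp flip: of_real_mult)
      then have "cinner x f *\<^sub>C f = (cinner x (L g) / r) *\<^sub>C L g"
        by (simp add: f_def cinner_scaleC_right scaleC_scaleC mult.assoc)
      then show ?thesis by (simp add: L'_def clinear_diff[OF L] clinear_scale[OF L])
    qed
    have L'g: "cinner (L' x) g = 0" for x
      using r by (simp add: L'_alt clinear_diff[OF L] clinear_scale[OF L] cinner_diff_left
          cinner_scaleC_left rg psd_selfadjoint[OF \<open>psd L\<close>])
    have "psd L'"
      unfolding psd_def
    proof (intro conjI allI)
      show "clinear L'"
        by (intro clinearI) (simp_all add: L'_def clinear_add[OF L] clinear_scale[OF L] cinner_add_left
            cinner_scaleC_left scaleC_add_left scaleC_scaleC complex_vector.scale_right_diff_distrib)
      show "cinner (L' x) y = cinner x (L' y)" for x y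
        using cinner_commute[of f y]
        by (simp add: L'_def cinner_diff_left cinner_diff_right cinner_scaleC_left cinner_scaleC_right
            psd_selfadjoint[OF \<open>psd L\<close>])
      show "0 \<le> L' x \<bullet> x" for x
      proof -
        let ?t = "cinner x (L g) / r"
        have "cinner (L' x) x = cinner (L' x) (x - ?t *\<^sub>C g)"
          by (simp add: cinner_diff_right cinner_scaleC_right L'g)
        then have "L' x \<bullet> x = L (x - ?t *\<^sub>C g) \<bullet> (x - ?t *\<^sub>C g)"
          by (metis L'_alt Re_cinner)
        then show ?thesis using psd_nonneg[OF \<open>psd L\<close>] by simp
      qed
    qed
    have "L' x \<in> cspan B" for x unfolding L'_alt using less.prems(2) by blast
    \<comment> \<open>The values of \<open>L'\<close> are orthogonal to \<open>g\<close>, whereas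
      \<open>L g\<close> is not; so fewer vectors span and the induction applies.\<close>
    moreover obtain B' where B': "finite B'" "card B' < card B" "{x \<in> cspan B. cinner x g = 0} \<subseteq> cspan B'"
      using cspan_kernel_smaller[OF less.prems(1), of "L g" g] less.prems(2) rg r by auto
    ultimately have "range L' \<subseteq> cspan B'" using L'g by blast
    \<comment> \<open>Unimodularity of \<open>\<nu> j\<close> makes the rank-one part invariant
      under conjugation by \<open>T j\<close>, so the remainder is invariant too.\<close>
    moreover have "T j (L' (cadjoint (T j) x)) = L' x" if "j \<in> J" for j x
    proof -
      have lin: "clinear (T j)" using T[OF that] by (rule bounded_clinear_imp_clinear)
      have "cinner (S j x) f = cinner x (T j f)" by (metis adj cinner_commute that)
      then have "T j (L' (S j x)) = L x - (cinner x f * (cnj (\<nu> j) * \<nu> j)) *\<^sub>C f"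
        using inv[OF that, of x]
        by (simp add: L'_def clinear_diff[OF lin] clinear_scale[OF lin] Tf[OF that] cinner_scaleC_right
            scaleC_scaleC S_def mult.commute mult.left_commute)
      also have "cnj (\<nu> j) * \<nu> j = 1"
        using \<mu>[OF that] complex_norm_square[of "\<mu> j"] by (simp add: \<nu>_def)
      finally show ?thesis by (simp add: S_def L'_def)
    qed
    ultimately obtain F where F: "\<forall>(f, \<nu>) \<in> set F. \<forall>j\<in>J. T j f = \<nu> j *\<^sub>C f \<and> cmod (\<nu> j) = 1"
      "\<And>h. L' h \<bullet> h = (\<Sum>(f, \<nu>) \<leftarrow> F. (cmod (cinner h f))\<^sup>2)"
      using less.hyps[OF B'(2,1) _ \<open>psd L'\<close> less.prems(4)] less.prems(5,6) by blast
    have "L h \<bullet> h = (cmod (cinner h f))\<^sup>2 + L' h \<bullet> h" for h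
    proof -
      have "cinner (cinner h f *\<^sub>C f) h = complex_of_real ((cmod (cinner h f))\<^sup>2)"
        unfolding cinner_scaleC_left complex_norm_square using cinner_commute[of f h] by simp
      then have "(cinner h f *\<^sub>C f) \<bullet> h = (cmod (cinner h f))\<^sup>2"
        by (metis Re_cinner Re_complex_of_real)
      then show ?thesis by (simp add: L'_def inner_diff_left)
    qed
    then show ?thesis
      using F Tf \<mu> by (intro exI[of _ "(f, \<nu>) # F"]) (auto simp: \<nu>_def)
  qed
qed

section \<open>Von Neumann's inequality for shifted sequences\<close>

lemma sum_periodic_shift:
  fixes h :: "nat \<Rightarrow> 'a::ab_group_add"
  assumes "\<And>k. h (k + N) = h k"
  shows "(\<Sum>k<N. h (k + e)) = (\<Sum>k<N. h k)"
proof (induction e)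
  case (Suc e)
  have "h e + (\<Sum>k<N. h (k + Suc e)) = (\<Sum>k<Suc N. h (k + e))"
    by (subst sum.lessThan_Suc_shift) simp
  also have "\<dots> = (\<Sum>k<N. h (k + e)) + h e" using assms[of e] by (simp add: add.commute)
  finally show ?case using Suc by (simp add: add.commute)
qed simp

text \<open>The sum is geometric in \<open>\<zeta>\<close>, a root of unity of order dividing
  \<open>N\<close> that equals 1 only for \<open>k = l\<close>.\<close>

lemma root_of_unity_orthogonality:
  fixes k l N :: nat
  assumes "k < N" "l < N"
  defines "\<omega> \<equiv> cis (2 * pi / N)"
  shows "(\<Sum>j<N. \<omega> ^ (j * k) * cnj (\<omega> ^ (j * l))) = (if k = l then of_nat N else 0)"
proof -
  define \<zeta> where "\<zeta> = \<omega> ^ k * cnj (\<omega> ^ l)"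
  have pow: "\<omega> ^ j = cis (2 * pi * real j / real N)" for j
    by (simp add: \<omega>_def Complex.DeMoivre mult.commute)
  have unit: "cnj (\<omega> ^ j) * \<omega> ^ j = 1" for j
    unfolding pow by (simp add: cis_cnj cis_mult)
  have "\<omega> ^ (j * k) * cnj (\<omega> ^ (j * l)) = \<zeta> ^ j" for j
    by (simp add: \<zeta>_def power_mult_distrib mult.commute flip: power_mult)
  then have sum: "(\<Sum>j<N. \<omega> ^ (j * k) * cnj (\<omega> ^ (j * l))) = (\<Sum>j<N. \<zeta> ^ j)" by simp
  show ?thesis
  proof (cases "k = l")
    case True
    then have "\<zeta> = 1" using unit by (simp add: \<zeta>_def mult.commute)
    then show ?thesis using True sum by simp
  next
    case False
    have "\<omega> ^ N = 1" using assms(1) by (simp add: \<omega>_def Complex.DeMoivre)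
    then have "\<zeta> ^ N = 1"
      unfolding \<zeta>_def power_mult_distrib complex_cnj_power power_mult[symmetric] mult.commute[of _ N]
      by (simp add: power_mult flip: complex_cnj_power)
    moreover have "\<zeta> \<noteq> 1"
    proof
      assume "\<zeta> = 1"
      then have "\<omega> ^ k * (cnj (\<omega> ^ l) * \<omega> ^ l) = \<omega> ^ l" by (simp add: \<zeta>_def flip: mult.assoc)
      then have "\<omega> ^ k = \<omega> ^ l" by (simp only: unit mult_1_right)
      then show False
        using bij_betw_imp_inj_on[OF Complex.bij_betw_roots_unity[of N]] assms(1,2) False
        unfolding pow by (auto dest: inj_onD)
    qed
    ultimately show ?thesis using False sum by (simp add: geometric_sum)
  qed
qed

lemma discrete_parseval:
  fixes a :: "nat \<Rightarrow> complex" and N :: nat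
  defines "\<omega> \<equiv> cis (2 * pi / N)"
  shows "(\<Sum>j<N. (cmod (\<Sum>k<N. a k * \<omega> ^ (j * k)))\<^sup>2) = N * (\<Sum>k<N. (cmod (a k))\<^sup>2)"
proof -
  have "complex_of_real (\<Sum>j<N. (cmod (\<Sum>k<N. a k * \<omega> ^ (j * k)))\<^sup>2) =
      (\<Sum>j<N. \<Sum>k<N. \<Sum>l<N. a k * cnj (a l) * (\<omega> ^ (j * k) * cnj (\<omega> ^ (j * l))))"
    unfolding of_real_sum complex_norm_square cnj_sum sum_product
    by (simp add: mult_ac)
  also have "\<dots> = (\<Sum>k<N. \<Sum>l<N. a k * cnj (a l) * (\<Sum>j<N. \<omega> ^ (j * k) * cnj (\<omega> ^ (j * l))))"
    unfolding sum_distrib_left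
    by (subst sum.swap, rule sum.cong[OF refl], rule sum.swap)
  also have "\<dots> = (\<Sum>k<N. \<Sum>l<N. if l = k then of_nat N * (a k * cnj (a l)) else 0)"
    unfolding \<omega>_def by (intro sum.cong refl, subst root_of_unity_orthogonality) auto
  also have "\<dots> = complex_of_real (N * (\<Sum>k<N. (cmod (a k))\<^sup>2))"
    by (simp add: sum_distrib_left complex_norm_square del: of_real_power)
  finally show ?thesis by (simp only: of_real_eq_iff)
qed

text \<open>Replacing \<open>a\<close> by a periodic sequence that agrees with it on the relevant indices makes the
  discrete Fourier transform turn the shifts into multiplication by \<open>z ^ e m\<close>.\<close>

lemma shift_polynomial_inequality:
  fixes a :: "nat \<Rightarrow> complex" and c :: "'m \<Rightarrow> complex" and e :: "'m \<Rightarrow> nat"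
  assumes e: "\<And>m. m \<in> M \<Longrightarrow> e m \<le> d"
    and C: "\<And>z. cmod z = 1 \<Longrightarrow> cmod (\<Sum>m\<in>M. c m * z ^ e m) \<le> C"
  shows "(\<Sum>k<K. (cmod (\<Sum>m\<in>M. c m * a (k + e m)))\<^sup>2) \<le> C\<^sup>2 * (\<Sum>k<K + d. (cmod (a k))\<^sup>2)"
proof (cases "K + d = 0")
  case True
  then show ?thesis by simp
next
  case False
  \<comment> \<open>For \<open>k < K\<close> and \<open>e m \<le> d\<close> the index
    \<open>k + e m\<close> stays below \<open>N\<close>, so periodisation leaves the sums to be
    estimated unchanged.\<close>
  define N where "N = K + d"
  define \<omega> where "\<omega> = cis (2 * pi / N)"
  define a' where "a' k = a (k mod N)" for k
  define b where "b k = (\<Sum>m\<in>M. c m * a' (k + e m))" for k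
  have N: "N > 0" using False by (simp add: N_def)
  have \<omega>N: "\<omega> ^ N = 1" using N by (simp add: \<omega>_def Complex.DeMoivre)
  have unit: "\<omega> * cnj \<omega> = 1" by (simp add: \<omega>_def cis_cnj cis_mult)
  have C0: "C \<ge> 0" using C[of 1] norm_ge_zero order_trans by (metis norm_one)
  have dft: "(\<Sum>k<N. b k * \<omega> ^ (j * k)) =
      (\<Sum>m\<in>M. c m * (cnj \<omega> ^ j) ^ e m) * (\<Sum>k<N. a' k * \<omega> ^ (j * k))" for j
  proof -
    have "(\<Sum>k<N. a' (k + s) * \<omega> ^ (j * k)) = (cnj \<omega> ^ j) ^ s * (\<Sum>k<N. a' k * \<omega> ^ (j * k))" for s
    proof -
      have "\<omega> ^ (j * (k + s)) * (cnj \<omega> ^ j) ^ s = \<omega> ^ (j * k) * (\<omega> * cnj \<omega>) ^ (j * s)" for k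
        by (simp only: power_mult_distrib power_add distrib_left power_mult mult.assoc)
      then have "\<omega> ^ (j * k) = \<omega> ^ (j * (k + s)) * (cnj \<omega> ^ j) ^ s" for k
        by (simp add: unit)
      then have "(\<Sum>k<N. a' (k + s) * \<omega> ^ (j * k)) =
          (\<Sum>k<N. (cnj \<omega> ^ j) ^ s * (a' (k + s) * \<omega> ^ (j * (k + s))))"
        by (intro sum.cong) (simp_all add: mult_ac)
      also have "\<dots> = (cnj \<omega> ^ j) ^ s * (\<Sum>k<N. a' (k + s) * \<omega> ^ (j * (k + s)))"
        by (simp only: sum_distrib_left)
      also have "(\<Sum>k<N. a' (k + s) * \<omega> ^ (j * (k + s))) = (\<Sum>k<N. a' k * \<omega> ^ (j * k))"
      proof (rule sum_periodic_shift)
        have "\<omega> ^ (j * N) = 1" by (metis \<omega>N mult.commute power_mult power_one)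
        then show "a' (k + N) * \<omega> ^ (j * (k + N)) = a' k * \<omega> ^ (j * k)" for k
          by (simp add: a'_def distrib_left power_add)
      qed
      finally show ?thesis .
    qed
    note shift = this
    have "(\<Sum>k<N. b k * \<omega> ^ (j * k)) = (\<Sum>m\<in>M. c m * (\<Sum>k<N. a' (k + e m) * \<omega> ^ (j * k)))"
      unfolding b_def sum_distrib_left sum_distrib_right by (subst sum.swap) (simp add: mult.assoc)
    then show ?thesis unfolding shift by (simp add: sum_distrib_right mult.assoc)
  qed
  have "N * (\<Sum>k<N. (cmod (b k))\<^sup>2) = (\<Sum>j<N. (cmod (\<Sum>k<N. b k * \<omega> ^ (j * k)))\<^sup>2)"
    unfolding \<omega>_def by (rule discrete_parseval[symmetric])
  also have "\<dots> \<le> (\<Sum>j<N. C\<^sup>2 * (cmod (\<Sum>k<N. a' k * \<omega> ^ (j * k)))\<^sup>2)"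
  proof (rule sum_mono)
    fix j
    have "cmod (cnj \<omega> ^ j) = 1" by (simp add: \<omega>_def norm_power)
    then have "cmod (\<Sum>k<N. b k * \<omega> ^ (j * k)) \<le> C * cmod (\<Sum>k<N. a' k * \<omega> ^ (j * k))"
      unfolding dft norm_mult by (intro mult_right_mono C) auto
    from power_mono[OF this norm_ge_zero]
    show "(cmod (\<Sum>k<N. b k * \<omega> ^ (j * k)))\<^sup>2 \<le> C\<^sup>2 * (cmod (\<Sum>k<N. a' k * \<omega> ^ (j * k)))\<^sup>2"
      by (simp add: power_mult_distrib)
  qed
  also have "\<dots> = N * (C\<^sup>2 * (\<Sum>k<N. (cmod (a' k))\<^sup>2))"
    unfolding sum_distrib_left[symmetric] \<omega>_def discrete_parseval by simp
  finally have "(\<Sum>k<N. (cmod (b k))\<^sup>2) \<le> C\<^sup>2 * (\<Sum>k<N. (cmod (a' k))\<^sup>2)"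
    using N by simp
  also have "(\<Sum>k<N. (cmod (a' k))\<^sup>2) = (\<Sum>k<K + d. (cmod (a k))\<^sup>2)"
    by (simp add: a'_def N_def)
  finally have "(\<Sum>k<N. (cmod (b k))\<^sup>2) \<le> C\<^sup>2 * (\<Sum>k<K + d. (cmod (a k))\<^sup>2)" .
  moreover have "(\<Sum>k<K. (cmod (\<Sum>m\<in>M. c m * a (k + e m)))\<^sup>2) = (\<Sum>k<K. (cmod (b k))\<^sup>2)"
  proof (intro sum.cong refl)
    fix k assume "k \<in> {..<K}"
    then have "a' (k + e m) = a (k + e m)" if "m \<in> M" for m
      using e[OF that] by (simp add: a'_def N_def)
    then show "(cmod (\<Sum>m\<in>M. c m * a (k + e m)))\<^sup>2 = (cmod (b k))\<^sup>2" by (simp add: b_def)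
  qed
  moreover have "(\<Sum>k<K. (cmod (b k))\<^sup>2) \<le> (\<Sum>k<N. (cmod (b k))\<^sup>2)"
    by (intro sum_mono2) (auto simp: N_def)
  ultimately show ?thesis by linarith
qed

section \<open>Unions of coordinate lines\<close>

lemma poly_eval_superset:
  assumes "finite A" "Poly_Mapping.keys p \<subseteq> A"
  shows "poly_eval p z = (\<Sum>m\<in>A. Poly_Mapping.lookup p m * (\<Prod>i\<in>UNIV. (z $ i) ^ Poly_Mapping.lookup m i))"
  unfolding poly_eval_def using assms
  by (intro sum.mono_neutral_left) (auto simp: in_keys_iff)

lemma poly_eval_add: "poly_eval (p + q) z = poly_eval p z + poly_eval q z"
proof -
  let ?A = "Poly_Mapping.keys p \<union> Poly_Mapping.keys q"
  have "Poly_Mapping.keys (p + q) \<subseteq> ?A" by (rule Poly_Mapping.keys_add)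
  then show ?thesis
    by (simp add: poly_eval_superset[of ?A] lookup_add distrib_right sum.distrib)
qed

lemma poly_eval_0 [simp]: "poly_eval 0 z = 0"
  by (simp add: poly_eval_def)

lemma poly_eval_sum: "poly_eval (\<Sum>i\<in>I. f i) z = (\<Sum>i\<in>I. poly_eval (f i) z)"
  by (induction I rule: infinite_finite_induct) (simp_all add: poly_eval_add)

lemma poly_eval_single:
  "poly_eval (Poly_Mapping.single m c) z = c * (\<Prod>i\<in>UNIV. (z $ i) ^ Poly_Mapping.lookup m i)"
  by (simp add: poly_eval_def)

lemma poly_eval_const: "poly_eval (Poly_Mapping.single 0 c) z = c"
  by (simp add: poly_eval_single)

lemma poly_eval_variable: "poly_eval (Poly_Mapping.single (Poly_Mapping.single j 1) 1) z = z $ j"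
proof -
  have "(\<Prod>i\<in>UNIV. (z $ i) ^ Poly_Mapping.lookup (Poly_Mapping.single j 1) i) =
      (\<Prod>i\<in>UNIV. if i = j then z $ i else 1)"
    by (intro prod.cong) (auto simp: lookup_single when_def)
  then show ?thesis by (simp add: poly_eval_single)
qed

text \<open>For unions of zero sets only the values of the product matter; the witness is the
  expanded double sum.\<close>

lemma poly_eval_product_exists: "\<exists>r. \<forall>z. poly_eval r z = poly_eval p z * poly_eval q z"
proof (intro exI allI)
  fix z
  show "poly_eval (\<Sum>m\<in>Poly_Mapping.keys p. \<Sum>m'\<in>Poly_Mapping.keys q.
      Poly_Mapping.single (m + m') (Poly_Mapping.lookup p m * Poly_Mapping.lookup q m')) z =
    poly_eval p z * poly_eval q z"
    unfolding poly_eval_sum poly_eval_single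
    by (simp add: poly_eval_def sum_product lookup_add power_add prod.distrib mult_ac)
qed

section \<open>Finite unions and intersections of varieties\<close>

lemma algebraic_variety_Un:
  assumes "algebraic_variety A" "algebraic_variety B"
  shows "algebraic_variety (A \<union> B)"
proof -
  from assms obtain P Q where P: "A = {z. \<forall>p\<in>P. poly_eval p z = 0}" and Q: "B = {z. \<forall>p\<in>Q. poly_eval p z = 0}"
    by (auto simp: algebraic_variety_def)
  define R where "R = {r. \<exists>p\<in>P. \<exists>q\<in>Q. \<forall>z. poly_eval r z = poly_eval p z * poly_eval q z}"
  have "A \<union> B = {z. \<forall>r\<in>R. poly_eval r z = 0}"
  proof (intro equalityI subsetI)
    fix z assume z: "z \<in> {z. \<forall>r\<in>R. poly_eval r z = 0}"
    have "poly_eval p z = 0 \<or> poly_eval q z = 0" if pq: "p \<in> P" "q \<in> Q" for p q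
    proof -
      obtain r where r: "\<forall>z. poly_eval r z = poly_eval p z * poly_eval q z"
        using poly_eval_product_exists by blast
      then have "r \<in> R" using pq by (auto simp: R_def)
      then have "poly_eval r z = 0" using z by blast
      then show ?thesis using r by (metis mult_eq_0_iff)
    qed
    then show "z \<in> A \<union> B" unfolding P Q by blast
  qed (auto simp: P Q R_def)
  then show ?thesis by (auto simp: algebraic_variety_def)
qed

lemma algebraic_variety_Int:
  assumes "algebraic_variety A" "algebraic_variety B"
  shows "algebraic_variety (A \<inter> B)"
proof -
  from assms obtain P Q where "A = {z. \<forall>p\<in>P. poly_eval p z = 0}" "B = {z. \<forall>p\<in>Q. poly_eval p z = 0}"
    by (auto simp: algebraic_variety_def)
  then have "A \<inter> B = {z. \<forall>p\<in>P \<union> Q. poly_eval p z = 0}" by auto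
  then show ?thesis unfolding algebraic_variety_def by blast
qed

lemma algebraic_variety_empty: "algebraic_variety {}"
  unfolding algebraic_variety_def
  by (rule exI[of _ "{Poly_Mapping.single 0 1}"]) (simp add: poly_eval_const del: single_one)

lemma algebraic_variety_UN:
  "finite I \<Longrightarrow> (\<And>i. i \<in> I \<Longrightarrow> algebraic_variety (f i)) \<Longrightarrow> algebraic_variety (\<Union>i\<in>I. f i)"
  by (induction I rule: finite_induct) (auto intro: algebraic_variety_Un algebraic_variety_empty)

lemma algebraic_variety_fixed_coordinates: "algebraic_variety {z. \<forall>j\<in>J. z $ j = w j}"
proof -
  define p where "p j = Poly_Mapping.single (Poly_Mapping.single j (1::nat)) 1 + Poly_Mapping.single 0 (- w j)" for j
  have "poly_eval (p j) z = z $ j - w j" for j z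
    unfolding p_def poly_eval_add poly_eval_const poly_eval_variable by simp
  then have "{z. \<forall>j\<in>J. z $ j = w j} = {z. \<forall>q\<in>p ` J. poly_eval q z = 0}" by auto
  then show ?thesis unfolding algebraic_variety_def by blast
qed

lemma algebraic_variety_finite:
  fixes A :: "(complex ^ 'n::finite) set"
  assumes "finite A"
  shows "algebraic_variety A"
proof -
  have "{z. \<forall>j\<in>UNIV. z $ j = w $ j} = {w}" for w :: "complex ^ 'n"
    by (auto simp: vec_eq_iff)
  then have "algebraic_variety {w}" for w :: "complex ^ 'n"
    using algebraic_variety_fixed_coordinates[of UNIV "\<lambda>j. w $ j"] by simp
  then show ?thesis using algebraic_variety_UN[OF assms, of "\<lambda>w. {w}"] by simp
qed

section \<open>Coordinate lines\<close>

definition coord_line :: "'n \<Rightarrow> ('n \<Rightarrow> complex) \<Rightarrow> (complex ^ 'n::finite) set" where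
  "coord_line i \<nu> = {z. \<forall>j\<in>- {i}. z $ j = \<nu> j}"

definition line_point :: "'n \<Rightarrow> ('n \<Rightarrow> complex) \<Rightarrow> complex \<Rightarrow> complex ^ 'n::finite" where
  "line_point i \<nu> t = (\<chi> j. if j = i then t else \<nu> j)"

lemma coord_line_eq_range: "coord_line i \<nu> = range (line_point i \<nu>)"
proof (intro equalityI subsetI)
  fix z assume "z \<in> coord_line i \<nu>"
  then have "z = line_point i \<nu> (z $ i)" by (auto simp: coord_line_def line_point_def vec_eq_iff)
  then show "z \<in> range (line_point i \<nu>)" by blast
qed (auto simp: coord_line_def line_point_def split: if_splits)

lemma inj_line_point: "inj (line_point i \<nu>)"
  by (rule injI) (auto simp: line_point_def vec_eq_iff split: if_splits)

lemma infinite_coord_line: "infinite (coord_line i \<nu>)"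
  unfolding coord_line_eq_range using finite_imageD[OF _ inj_line_point] infinite_UNIV_char_0 by blast

lemma algebraic_variety_coord_line: "algebraic_variety (coord_line i \<nu>)"
  unfolding coord_line_def by (rule algebraic_variety_fixed_coordinates)

text \<open>Collects the restriction of \<open>p\<close> as a polynomial in \<open>t\<close>, with
  the same coefficients that appear in \<open>poly_operator_eigenvector\<close>.\<close>

lemma poly_eval_line_point:
  "poly_eval p (line_point i \<nu> t) = (\<Sum>m\<in>Poly_Mapping.keys p.
     (Poly_Mapping.lookup p m * (\<Prod>j\<in>- {i}. \<nu> j ^ Poly_Mapping.lookup m j)) * t ^ Poly_Mapping.lookup m i)"
proof -
  have "(\<Prod>j\<in>UNIV. (line_point i \<nu> t $ j) ^ Poly_Mapping.lookup m j) =
      t ^ Poly_Mapping.lookup m i * (\<Prod>j\<in>- {i}. \<nu> j ^ Poly_Mapping.lookup m j)" for m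
  proof -
    have "(\<Prod>j\<in>- {i}. (line_point i \<nu> t $ j) ^ Poly_Mapping.lookup m j) =
        (\<Prod>j\<in>- {i}. \<nu> j ^ Poly_Mapping.lookup m j)"
      by (intro prod.cong) (auto simp: line_point_def)
    then show ?thesis
      by (subst prod.remove[of UNIV i]) (auto simp: Compl_eq_Diff_UNIV line_point_def)
  qed
  then show ?thesis unfolding poly_eval_def by (simp add: mult_ac)
qed

text \<open>Along \<open>line_point\<close> the equations become polynomials in one variable: either
  all of them vanish identically, or a nonzero one leaves finitely many roots.\<close>

lemma algebraic_subset_of_line:
  assumes "algebraic_variety A" "A \<subseteq> coord_line i \<nu>"
  shows "A = coord_line i \<nu> \<or> finite A"
proof -
  obtain P where P: "A = {z. \<forall>p\<in>P. poly_eval p z = 0}" using assms(1) by (auto simp: algebraic_variety_def)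
  define q where "q p = (\<Sum>m\<in>Poly_Mapping.keys p.
     monom (Poly_Mapping.lookup p m * (\<Prod>j\<in>- {i}. \<nu> j ^ Poly_Mapping.lookup m j)) (Poly_Mapping.lookup m i))" for p
  have q: "poly_eval p (line_point i \<nu> t) = poly (q p) t" for p t
    by (simp add: poly_eval_line_point q_def poly_sum poly_monom)
  show ?thesis
  proof (cases "\<forall>p\<in>P. q p = 0")
    case True
    then have "coord_line i \<nu> \<subseteq> A" by (auto simp: coord_line_eq_range P q)
    then show ?thesis using assms(2) by blast
  next
    case False
    then obtain p where p: "p \<in> P" "q p \<noteq> 0" by blast
    have "A \<subseteq> line_point i \<nu> ` {t. poly (q p) t = 0}"
    proof
      fix z assume z: "z \<in> A"
      then obtain t where t: "z = line_point i \<nu> t" using assms(2) by (auto simp: coord_line_eq_range)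
      then show "z \<in> line_point i \<nu> ` {t. poly (q p) t = 0}" using z p(1) by (auto simp: P simp flip: q)
    qed
    then show ?thesis using poly_roots_finite[OF p(2)] finite_subset by blast
  qed
qed

text \<open>Two proper algebraic subsets would be finite and could not cover an infinite
  line.\<close>

lemma irreducible_coord_line: "irreducible_variety (coord_line i \<nu>)"
  unfolding irreducible_variety_def
proof (intro conjI allI impI)
  show "coord_line i \<nu> \<noteq> {}" using infinite_coord_line[of i \<nu>] by auto
  fix A B assume "algebraic_variety A" "algebraic_variety B" "coord_line i \<nu> = A \<union> B"
  then show "coord_line i \<nu> = A \<or> coord_line i \<nu> = B"
    using algebraic_subset_of_line[of A i \<nu>] algebraic_subset_of_line[of B i \<nu>] infinite_coord_line[of i \<nu>]
    by (metis finite_Un sup_ge1 sup_ge2)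
qed (rule algebraic_variety_coord_line)

section \<open>Irreducible sets, dimension and symmetry\<close>

lemma irreducible_singleton: "irreducible_variety {w}"
  unfolding irreducible_variety_def by (auto intro: algebraic_variety_finite simp: singleton_Un_iff)

text \<open>A point and its finite complement are both algebraic, so the decomposition must be
  trivial.\<close>

lemma irreducible_finite:
  assumes "irreducible_variety Z" "finite Z"
  shows "\<exists>w. Z = {w}"
proof -
  obtain w where w: "w \<in> Z" using assms by (auto simp: irreducible_variety_def)
  have "Z = {w} \<union> (Z - {w})" using w by auto
  then have "Z = {w} \<or> Z = Z - {w}"
    using assms unfolding irreducible_variety_def by (metis algebraic_variety_finite finite.emptyI finite_Diff finite_insert)
  then show ?thesis using w by blast
qed

lemma irreducible_subset_UN:
  assumes "irreducible_variety Z" "finite I" "\<And>i. i \<in> I \<Longrightarrow> algebraic_variety (f i)" "Z \<subseteq> (\<Union>i\<in>I. f i)"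
  shows "\<exists>i\<in>I. Z \<subseteq> f i"
  using assms(2-)
proof (induction I rule: finite_induct)
  case empty
  then show ?case using assms(1) by (auto simp: irreducible_variety_def)
next
  case (insert i I)
  have "algebraic_variety (Z \<inter> f i)" "algebraic_variety (Z \<inter> (\<Union>i\<in>I. f i))"
    using assms(1) insert by (auto intro!: algebraic_variety_Int algebraic_variety_UN simp: irreducible_variety_def)
  moreover have "Z = (Z \<inter> f i) \<union> (Z \<inter> (\<Union>i\<in>I. f i))" using insert.prems(2) by auto
  ultimately have "Z = Z \<inter> f i \<or> Z = Z \<inter> (\<Union>i\<in>I. f i)"
    using assms(1) unfolding irreducible_variety_def by blast
  then show ?case
  proof
    assume "Z = Z \<inter> (\<Union>i\<in>I. f i)"
    then have "Z \<subseteq> (\<Union>i\<in>I. f i)" by blast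
    then show ?thesis using insert by auto
  qed blast
qed

text \<open>A point on a line is a chain of length 1. In a chain of length 2 or more,
  \<open>Z 2\<close> lies in a single line, so \<open>Z 1\<close> is finite, hence a point, and
  \<open>Z 0\<close> would be empty.\<close>

lemma variety_dim_lines:
  assumes "finite \<Lambda>" "\<Lambda> \<noteq> {}"
  shows "variety_dim (\<Union>(i, \<nu>)\<in>\<Lambda>. coord_line i \<nu>) = 1"
proof (rule antisym)
  let ?W = "\<Union>(i, \<nu>)\<in>\<Lambda>. coord_line i \<nu>"
  obtain i \<nu> where i: "(i, \<nu>) \<in> \<Lambda>" using assms(2) by auto
  define w where "w = line_point i \<nu> 0"
  have w: "w \<in> coord_line i \<nu>" by (simp add: w_def coord_line_eq_range)
  moreover have "{w} \<noteq> coord_line i \<nu>"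
    using infinite_coord_line[of i \<nu>] by (metis finite.emptyI finite_insert)
  ultimately have "{w} \<subset> coord_line i \<nu>" by blast
  then have "\<exists>Z. (\<forall>k\<le>1. irreducible_variety (Z k) \<and> Z k \<subseteq> ?W) \<and> (\<forall>k<1. Z k \<subset> Z (Suc k))"
    using i w by (intro exI[of _ "\<lambda>k::nat. if k = 0 then {w} else coord_line i \<nu>"])
      (auto simp: irreducible_singleton irreducible_coord_line)
  then have "enat 1 \<le> variety_dim ?W" unfolding variety_dim_def by (intro Sup_upper) blast
  then show "1 \<le> variety_dim ?W" by (simp add: one_enat_def)
  have "k \<le> 1" if chain: "\<forall>j\<le>k. irreducible_variety (Z j) \<and> Z j \<subseteq> ?W" "\<forall>j<k. Z j \<subset> Z (Suc j)" for k Z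
  proof (rule ccontr)
    note Z = chain[rule_format]
    assume "\<not> k \<le> 1"
    then have k: "2 \<le> k" by simp
    have "\<exists>l\<in>\<Lambda>. Z 2 \<subseteq> (case l of (i, \<nu>) \<Rightarrow> coord_line i \<nu>)"
      using Z(1)[OF k] assms(1)
      by (intro irreducible_subset_UN) (auto intro: algebraic_variety_coord_line)
    then obtain i \<nu> where l: "Z 2 \<subseteq> coord_line i \<nu>" by auto
    have "Z 1 \<subset> Z 2" "Z 0 \<subset> Z 1" using Z(2)[of 1] Z(2)[of 0] k by (auto simp: numeral_2_eq_2)
    then have "finite (Z 1)" using algebraic_subset_of_line[of "Z 1" i \<nu>] l Z(1)[of 1] k
      by (auto simp: irreducible_variety_def)
    then obtain w where "Z 1 = {w}" using irreducible_finite[of "Z 1"] Z(1)[of 1] k by auto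
    then have "Z 0 = {}" using \<open>Z 0 \<subset> Z 1\<close> by (auto simp: psubset_eq subset_singleton_iff)
    then show False using Z(1)[of 0] by (simp add: irreducible_variety_def)
  qed
  then show "variety_dim ?W \<le> 1"
    unfolding variety_dim_def by (intro Sup_least) (force simp: one_enat_def)
qed

text \<open>The reflection sending z to 1 / cnj z fixes every unimodular number and so preserves
  each equation \<open>z $ j = \<nu> j\<close>; the remaining coordinate is free.\<close>

lemma symmetric_lines:
  assumes "\<And>i \<nu> j. (i, \<nu>) \<in> \<Lambda> \<Longrightarrow> j \<noteq> i \<Longrightarrow> cmod (\<nu> j) = 1"
  shows "symmetric_variety (\<Union>(i, \<nu>)\<in>\<Lambda>. coord_line i \<nu>)"
  unfolding symmetric_variety_def
proof (intro allI impI)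
  fix z :: "complex ^ 'a" assume z: "\<forall>i. z $ i \<noteq> 0"
  have "z $ j = \<nu> j \<longleftrightarrow> 1 / cnj (z $ j) = \<nu> j" if "cmod (\<nu> j) = 1" for \<nu> j
  proof -
    have "\<nu> j * cnj (\<nu> j) = 1" using that complex_norm_square[of "\<nu> j"] by simp
    then have inv: "\<nu> j \<noteq> 0" "1 / cnj (\<nu> j) = \<nu> j" by (auto simp: divide_eq_eq)
    show ?thesis
    proof
      assume "1 / cnj (z $ j) = \<nu> j"
      then have "cnj (z $ j) = 1 / \<nu> j" using z inv(1) by (auto simp: field_simps)
      then have "z $ j = 1 / cnj (\<nu> j)" by (metis complex_cnj_cnj complex_cnj_divide complex_cnj_one)
      then show "z $ j = \<nu> j" using inv by simp
    qed (use inv in simp)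
  qed
  then have "z \<in> coord_line i \<nu> \<longleftrightarrow> (\<chi> i. 1 / cnj (z $ i)) \<in> coord_line i \<nu>" if "(i, \<nu>) \<in> \<Lambda>" for i \<nu>
    using assms[OF that] by (auto simp: coord_line_def)
  then show "z \<in> (\<Union>(i, \<nu>)\<in>\<Lambda>. coord_line i \<nu>) \<longleftrightarrow>
      (\<chi> i. 1 / cnj (z $ i)) \<in> (\<Union>(i, \<nu>)\<in>\<Lambda>. coord_line i \<nu>)"
    by fast
qed

section \<open>The defect operator\<close>

text \<open>The defect is the square of \<open>defect_operator S\<close>, so its range lies in the
  defect space. This passes the finite dimension on to the defect itself.\<close>

lemma defect_operator_positive_sqrt:
  assumes "contraction S"
  shows "psd (\<lambda>x. x - S (cadjoint S x))"
    and "range (\<lambda>x. x - S (cadjoint S x)) \<subseteq> defect_space S"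
proof -
  have bc: "bounded_clinear S" and "onorm S \<le> 1" using assms by (auto simp: contraction_def)
  have S: "norm (S x) \<le> norm x" for x
    using onorm[of S x] bc \<open>onorm S \<le> 1\<close> mult_right_mono[of "onorm S" 1 "norm x"]
    by (simp add: bounded_clinear_def)
  have S': "norm (cadjoint S x) \<le> norm x" for x using norm_cadjoint_le[OF bc, of 1] S by simp
  have "bounded_clinear (\<lambda>x. S (cadjoint S x))"
    using bounded_clinear_comp[OF bc bounded_clinear_cadjoint[OF bc]] by (simp add: comp_def)
  moreover have "norm (S (cadjoint S x)) \<le> norm x" for x using S S' order_trans by blast
  moreover have "cinner (S (cadjoint S x)) y = cinner x (S (cadjoint S y))" for x y
    by (simp add: cinner_cadjoint[OF bc] cinner_cadjoint'[OF bc])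
  ultimately have D: "positive_operator (defect_operator S)"
      "defect_operator S \<circ> defect_operator S = (\<lambda>x. x - S (cadjoint S x))"
    unfolding defect_operator_def by (rule positive_operator_sqrt)+
  show "range (\<lambda>x. x - S (cadjoint S x)) \<subseteq> defect_space S"
    unfolding D(2)[symmetric] defect_space_def comp_def
    using closure_subset[of "range (defect_operator S)"] by blast
  have psd: "psd (defect_operator S)" by (rule positive_operator_psd[OF D(1)])
  show "psd (\<lambda>x. x - S (cadjoint S x))"
    unfolding D(2)[symmetric] psd_def
  proof (intro conjI allI)
    show "clinear (defect_operator S \<circ> defect_operator S)" by (intro clinear_compose psd_clinear psd)
    show "cinner ((defect_operator S \<circ> defect_operator S) x) y = cinner x ((defect_operator S \<circ> defect_operator S) y)" for x y
      by (simp add: psd_selfadjoint[OF psd])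
    have "(defect_operator S \<circ> defect_operator S) x \<bullet> x = defect_operator S x \<bullet> defect_operator S x" for x
      by (simp add: psd_selfadjoint[OF psd] flip: Re_cinner)
    then show "0 \<le> (defect_operator S \<circ> defect_operator S) x \<bullet> x" for x by simp
  qed
qed

lemma funpow_commute:
  assumes "\<And>x. f (g x) = g (f x)"
  shows "(f ^^ a) ((g ^^ b) x) = (g ^^ b) ((f ^^ a) x)"
proof -
  have 1: "f ((g ^^ b) x) = (g ^^ b) (f x)" for x by (induction b) (simp_all add: assms)
  show ?thesis by (induction a) (simp_all add: 1)
qed

section \<open>Commuting tuples\<close>

locale commuting_tuple =
  fixes T :: "'n::finite \<Rightarrow> 'h \<Rightarrow> 'h::chilbert_space"
  assumes bounded: "bounded_clinear (T i)"
    and commute: "T i (T j x) = T j (T i x)"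
begin

text \<open>The fold of \<open>operator_monomial\<close> over a subset, which allows induction on
  \<open>J\<close> and splitting off one index.\<close>

definition partial_monomial :: "('n \<Rightarrow> nat) \<Rightarrow> 'n set \<Rightarrow> 'h \<Rightarrow> 'h" where
  "partial_monomial m J = Finite_Set.fold (\<lambda>i R. (T i ^^ m i) \<circ> R) id J"

lemma partial_monomial_UNIV: "partial_monomial m UNIV = operator_monomial T m"
  by (simp add: partial_monomial_def operator_monomial_def)

lemma partial_monomial_empty [simp]: "partial_monomial m {} = id"
  by (simp add: partial_monomial_def)

lemma partial_monomial_insert:
  assumes "i \<notin> J"
  shows "partial_monomial m (insert i J) = (T i ^^ m i) \<circ> partial_monomial m J"
proof -
  \<comment> \<open>Commutation of the tuple makes the order of the fold immaterial.\<close>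
  interpret comp_fun_commute "\<lambda>i R. (T i ^^ m i) \<circ> R"
    by unfold_locales (auto simp: fun_eq_iff intro!: funpow_commute commute)
  show ?thesis unfolding partial_monomial_def by (rule fold_insert) (use assms in auto)
qed

lemma bounded_partial_monomial: "bounded_clinear (partial_monomial m J)"
proof -
  have "finite J" by simp
  then show ?thesis
  proof (induction J rule: finite_induct)
    case empty
    show ?case using bounded_clinear_funpow[OF bounded, of 0] by (simp only: partial_monomial_empty funpow.simps)
  next
    case (insert i J)
    show ?case
      unfolding partial_monomial_insert[OF insert.hyps(2)]
      by (intro bounded_clinear_comp bounded_clinear_funpow bounded insert.IH)
  qed
qed

lemma power_commute: "(T i ^^ a) ((T j ^^ b) x) = (T j ^^ b) ((T i ^^ a) x)"
  by (rule funpow_commute) (rule commute)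

lemma partial_monomial_commute: "partial_monomial m J ((T i ^^ k) x) = (T i ^^ k) (partial_monomial m J x)"
proof -
  have "finite J" by simp
  then show ?thesis
  proof (induction J rule: finite_induct)
    case (insert j J)
    then show ?case by (simp add: partial_monomial_insert power_commute[of _ j _ i])
  qed simp
qed

lemma partial_monomial_eigenvector:
  assumes "\<And>j. j \<in> J \<Longrightarrow> T j f = \<nu> j *\<^sub>C f"
  shows "partial_monomial m J f = (\<Prod>j\<in>J. \<nu> j ^ m j) *\<^sub>C f"
proof -
  have "finite J" by simp
  then show ?thesis using assms
  proof (induction J rule: finite_induct)
    case empty
    show ?case by (simp add: scaleC_one)
  next
    case (insert i J)
    have lin: "clinear (T i)" by (rule bounded_clinear_imp_clinear[OF bounded])
    have pow: "(T i ^^ k) f = \<nu> i ^ k *\<^sub>C f" for k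
      by (induction k) (simp_all add: scaleC_one clinear_scale[OF lin] insert.prems scaleC_scaleC mult.commute)
    show ?case
      using insert by (simp add: partial_monomial_insert clinear_scale[OF clinear_funpow[OF lin]] pow
          scaleC_scaleC mult.commute)
  qed
qed

text \<open>The power of \<open>T i\<close> moves outside by commutation, and the other factors act
  on \<open>f\<close> by their eigenvalues. What is left is a shift of the exponent by
  \<open>m i\<close>.\<close>

lemma operator_monomial_eigenvector:
  assumes "\<And>j. j \<in> - {i} \<Longrightarrow> T j f = \<nu> j *\<^sub>C f"
  shows "operator_monomial T m ((T i ^^ k) f) = (\<Prod>j\<in>- {i}. \<nu> j ^ m j) *\<^sub>C (T i ^^ (k + m i)) f"
proof -
  have lin: "clinear (T i ^^ l)" for l
    by (rule clinear_funpow[OF bounded_clinear_imp_clinear[OF bounded]])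
  have "UNIV = insert i (- {i})" by auto
  then have "operator_monomial T m = (T i ^^ m i) \<circ> partial_monomial m (- {i})"
    using partial_monomial_insert[of i "- {i}" m] by (simp flip: partial_monomial_UNIV)
  moreover have "operator_monomial T m ((T i ^^ k) f) = (T i ^^ k) (operator_monomial T m f)"
    using partial_monomial_commute[of m UNIV] by (simp add: partial_monomial_UNIV)
  moreover have "partial_monomial m (- {i}) f = (\<Prod>j\<in>- {i}. \<nu> j ^ m j) *\<^sub>C f"
    using assms by (rule partial_monomial_eigenvector)
  ultimately show ?thesis by (simp add: clinear_scale[OF lin] funpow_add)
qed

lemma bounded_poly_operator: "bounded_clinear (poly_operator p T)"
proof -
  have mono: "bounded_clinear (operator_monomial T m)" for m
    using bounded_partial_monomial by (simp flip: partial_monomial_UNIV)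
  have "bounded_linear (poly_operator p T)"
    unfolding poly_operator_def
    by (intro bounded_linear_sum bounded_linear_compose[OF bounded_linear_scaleC])
      (use mono in \<open>simp add: bounded_clinear_def\<close>)
  moreover have "poly_operator p T (c *\<^sub>C x) = c *\<^sub>C poly_operator p T x" for c x
    using clinear_scale[OF bounded_clinear_imp_clinear[OF mono]]
    by (simp add: poly_operator_def complex_vector.scale_sum_right scaleC_scaleC mult.commute)
  ultimately show ?thesis by (simp add: bounded_clinear_def)
qed

lemma poly_operator_eigenvector:
  assumes "\<And>j. j \<in> - {i} \<Longrightarrow> T j f = \<nu> j *\<^sub>C f"
  shows "poly_operator p T ((T i ^^ k) f) = (\<Sum>m\<in>Poly_Mapping.keys p.
    (Poly_Mapping.lookup p m * (\<Prod>j\<in>- {i}. \<nu> j ^ Poly_Mapping.lookup m j)) *\<^sub>C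
      (T i ^^ (k + Poly_Mapping.lookup m i)) f)"
proof -
  have "operator_monomial T m ((T i ^^ k) f) = (\<Prod>j\<in>- {i}. \<nu> j ^ m j) *\<^sub>C (T i ^^ (k + m i)) f" for m
    using assms by (rule operator_monomial_eigenvector)
  then show ?thesis by (simp add: poly_operator_def scaleC_scaleC)
qed

text \<open>The quadratic form of the defect \<Delta> of \<open>T i\<close>; with it the telescoping
  takes place in the real numbers.\<close>

definition defect_form :: "'n \<Rightarrow> 'h \<Rightarrow> real" where
  "defect_form i x = (x - T i (cadjoint (T i) x)) \<bullet> x"

lemma defect_form_eq: "defect_form i x = (norm x)\<^sup>2 - (norm (cadjoint (T i) x))\<^sup>2"
proof -
  have "T i (cadjoint (T i) x) \<bullet> x = cadjoint (T i) x \<bullet> cadjoint (T i) x"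
    using cinner_cadjoint[OF bounded, of i "cadjoint (T i) x" x] by (simp flip: Re_cinner)
  then show ?thesis by (simp add: defect_form_def inner_diff_left power2_norm_eq_inner)
qed

end

locale szego_zero_tuple = commuting_tuple T
  for T :: "'n::finite \<Rightarrow> 'h \<Rightarrow> 'h::chilbert_space" +
  assumes szego: "i \<noteq> j \<Longrightarrow> x - T i (cadjoint (T i) x) - T j (cadjoint (T j) x)
      + T i (T j (cadjoint (T i) (cadjoint (T j) x))) = 0"
begin

text \<open>The hypothesis on pairs, rearranged into the invariance premise of
  \<open>psd_invariant_decomposition\<close>.\<close>

lemma defect_conjugation:
  assumes "i \<noteq> j"
  shows "T j (cadjoint (T j) x - T i (cadjoint (T i) (cadjoint (T j) x))) = x - T i (cadjoint (T i) x)"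
  using szego[OF assms, of x] commute[of i j]
  by (simp add: clinear_diff[OF bounded_clinear_imp_clinear[OF bounded]] algebra_simps)

lemma defect_form_cadjoint:
  assumes "i \<noteq> j"
  shows "defect_form i (cadjoint (T j) x) = defect_form i x"
proof -
  let ?y = "cadjoint (T j) x"
  have "cinner (?y - T i (cadjoint (T i) ?y)) ?y = cinner (T j (?y - T i (cadjoint (T i) ?y))) x"
    by (simp add: cinner_cadjoint[OF bounded])
  then show ?thesis unfolding defect_form_def defect_conjugation[OF assms] by (metis Re_cinner)
qed

text \<open>Taken as the adjoint of a product, so that \<open>J = UNIV\<close> is literally the
  operator in the purity condition.\<close>

definition adjoint_product :: "'n set \<Rightarrow> 'h \<Rightarrow> 'h" where
  "adjoint_product J = cadjoint (partial_monomial (\<lambda>_. 1) J)"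

lemma adjoint_product_empty [simp]: "adjoint_product {} x = x"
  using cadjoint_eqI[of "id :: 'h \<Rightarrow> 'h" id] by (simp add: adjoint_product_def)

lemma adjoint_product_insert:
  "i \<notin> J \<Longrightarrow> adjoint_product (insert i J) x = adjoint_product J (cadjoint (T i) x)"
  unfolding adjoint_product_def
  using cadjoint_comp[OF bounded bounded_partial_monomial] by (simp add: partial_monomial_insert)

lemma defect_form_adjoint_product: "i \<notin> J \<Longrightarrow> defect_form i (adjoint_product J x) = defect_form i x"
proof -
  have "finite J" by simp
  then show "i \<notin> J \<Longrightarrow> ?thesis"
    by (induction J arbitrary: x rule: finite_induct)
      (simp_all add: adjoint_product_insert defect_form_cadjoint)
qed

text \<open>Applying \<open>cadjoint (T i)\<close> lowers the squared norm by the defect form of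
  \<open>i\<close> and leaves the forms of the other indices unchanged.\<close>

lemma norm_adjoint_product:
  "(norm x)\<^sup>2 - (norm (adjoint_product J x))\<^sup>2 = (\<Sum>j\<in>J. defect_form j x)"
proof -
  have "finite J" by simp
  then show ?thesis
  proof (induction J arbitrary: x rule: finite_induct)
    case (insert i J)
    have "(\<Sum>j\<in>J. defect_form j (cadjoint (T i) x)) = (\<Sum>j\<in>J. defect_form j x)"
      using insert.hyps by (intro sum.cong defect_form_cadjoint) auto
    then show ?case
      using insert.IH[of "cadjoint (T i) x"] insert.hyps
      by (simp add: adjoint_product_insert defect_form_eq[of i])
  qed simp
qed

lemma cadjoint_adjoint_product_commute:
  "cadjoint (T i) (adjoint_product J x) = adjoint_product J (cadjoint (T i) x)"
proof (rule cinner_ext_right)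
  fix y
  have "partial_monomial (\<lambda>_. 1) J (T i y) = T i (partial_monomial (\<lambda>_. 1) J y)"
    using partial_monomial_commute[of _ J 1 i y] by simp
  then show "cinner y (cadjoint (T i) (adjoint_product J x)) = cinner y (adjoint_product J (cadjoint (T i) x))"
    by (simp add: adjoint_product_def bounded bounded_partial_monomial flip: cinner_cadjoint)
qed

text \<open>Each full product contains \<open>cadjoint (T i)\<close> once; its other factors
  preserve the defect form of \<open>i\<close>.\<close>

lemma defect_form_adjoint_product_power:
  "defect_form i ((adjoint_product UNIV ^^ k) x) = defect_form i ((cadjoint (T i) ^^ k) x)"
proof (induction k arbitrary: x)
  case (Suc k)
  let ?Q = "adjoint_product UNIV"
  have com: "cadjoint (T i) ((?Q ^^ k) x) = (?Q ^^ k) (cadjoint (T i) x)" for x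
    by (induction k) (simp_all add: cadjoint_adjoint_product_commute)
  have "UNIV = insert i (- {i})" by auto
  then have "?Q y = adjoint_product (- {i}) (cadjoint (T i) y)" for y
    using adjoint_product_insert[of i "- {i}" y] by simp
  then have "defect_form i (?Q y) = defect_form i (cadjoint (T i) y)" for y
    by (simp add: defect_form_adjoint_product)
  then have "defect_form i ((?Q ^^ Suc k) x) = defect_form i ((?Q ^^ k) (cadjoint (T i) x))"
    by (simp add: com)
  also have "\<dots> = defect_form i ((cadjoint (T i) ^^ k) (cadjoint (T i) x))" by (rule Suc)
  finally show ?case by (simp add: funpow_swap1)
qed simp

text \<open>The inner sum is the drop in squared norm from the \<open>k\<close>-th to the next
  iterate of the full adjoint product.\<close>

lemma telescoped_defect_forms:
  "(\<Sum>k<K. \<Sum>i\<in>UNIV. defect_form i ((cadjoint (T i) ^^ k) x)) =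
    (norm x)\<^sup>2 - (norm ((adjoint_product UNIV ^^ K) x))\<^sup>2"
proof (induction K)
  case (Suc K)
  then show ?case
    using norm_adjoint_product[of "(adjoint_product UNIV ^^ K) x" UNIV]
    by (simp add: defect_form_adjoint_product_power)
qed simp

text \<open>Every vector is resolved by the coefficients \<open>cinner h ((T i ^^ k) f)\<close>, on which \<open>p(T)\<^sup>*\<close> acts
  through the restriction of \<open>p\<close> to a coordinate line.\<close>

lemma norm_poly_operator_le:
  fixes f :: "'n \<Rightarrow> nat \<Rightarrow> 'h" and \<nu> :: "'n \<Rightarrow> nat \<Rightarrow> 'n \<Rightarrow> complex"
  assumes pure: "pure_operator (operator_product T)"
    and form: "\<And>i h. defect_form i h = (\<Sum>r<N i. (cmod (cinner h (f i r)))\<^sup>2)"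
    and eig: "\<And>i r j. r < N i \<Longrightarrow> j \<in> - {i} \<Longrightarrow> T j (f i r) = \<nu> i r j *\<^sub>C f i r"
    and C: "0 \<le> C" "\<And>i r t. r < N i \<Longrightarrow> cmod t = 1 \<Longrightarrow> cmod (poly_eval p (line_point i (\<nu> i r) t)) \<le> C"
  shows "norm (poly_operator p T x) \<le> C * norm x"
proof -
  let ?A = "poly_operator p T"
  \<comment> \<open>The sum of all exponents in \<open>p\<close> bounds each of them, as the shift
    inequality requires.\<close>
  define d where "d = (\<Sum>m\<in>Poly_Mapping.keys p. \<Sum>i\<in>UNIV. Poly_Mapping.lookup m i)"
  have d: "Poly_Mapping.lookup m i \<le> d" if "m \<in> Poly_Mapping.keys p" for m i
  proof -
    have "Poly_Mapping.lookup m i \<le> (\<Sum>i\<in>UNIV. Poly_Mapping.lookup m i)"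
      by (rule member_le_sum) auto
    also have "\<dots> \<le> d" unfolding d_def by (rule member_le_sum) (use that in auto)
    finally show ?thesis .
  qed
  have pow: "cinner ((cadjoint (T i) ^^ k) h) y = cinner h ((T i ^^ k) y)" for i k h y
    using cinner_cadjoint'[OF bounded_clinear_funpow[OF bounded]]
    by (simp add: cadjoint_funpow[OF bounded])
  have coeff: "(\<Sum>k<K. \<Sum>i\<in>UNIV. defect_form i ((cadjoint (T i) ^^ k) h)) =
      (\<Sum>i\<in>UNIV. \<Sum>r<N i. \<Sum>k<K. (cmod (cinner ((T i ^^ k) (f i r)) h))\<^sup>2)" for K h
  proof -
    have *: "cmod (cinner ((cadjoint (T i) ^^ k) h) (f i r)) = cmod (cinner ((T i ^^ k) (f i r)) h)" for i k r
      by (metis pow cinner_commute complex_mod_cnj)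
    show ?thesis
      unfolding form * by (rule trans[OF sum.swap], rule sum.cong[OF refl], rule sum.swap)
  qed
  \<comment> \<open>By purity the truncated defect sums of \<open>cadjoint ?A h\<close> converge to
    its squared norm, so a bound uniform in \<open>K\<close> suffices.\<close>
  have "(norm (cadjoint ?A h))\<^sup>2 \<le> C\<^sup>2 * (norm h)\<^sup>2" for h
  proof (rule LIMSEQ_le_const2)
    have "cadjoint (operator_product T) = adjoint_product UNIV"
      by (simp add: adjoint_product_def operator_product_def partial_monomial_UNIV)
    then have "(\<lambda>K. (adjoint_product UNIV ^^ K) (cadjoint ?A h)) \<longlonglongrightarrow> 0"
      using pure by (simp add: pure_operator_def)
    then have "(\<lambda>K. (norm (cadjoint ?A h))\<^sup>2 - (norm ((adjoint_product UNIV ^^ K) (cadjoint ?A h)))\<^sup>2)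
        \<longlonglongrightarrow> (norm (cadjoint ?A h))\<^sup>2 - (norm (0::'h))\<^sup>2"
      by (intro tendsto_intros)
    then show "(\<lambda>K. \<Sum>k<K. \<Sum>i\<in>UNIV. defect_form i ((cadjoint (T i) ^^ k) (cadjoint ?A h)))
        \<longlonglongrightarrow> (norm (cadjoint ?A h))\<^sup>2"
      by (simp add: telescoped_defect_forms)
    have "(\<Sum>k<K. \<Sum>i\<in>UNIV. defect_form i ((cadjoint (T i) ^^ k) (cadjoint ?A h))) \<le> C\<^sup>2 * (norm h)\<^sup>2" for K
    proof -
      have "(\<Sum>k<K. \<Sum>i\<in>UNIV. defect_form i ((cadjoint (T i) ^^ k) (cadjoint ?A h))) =
          (\<Sum>i\<in>UNIV. \<Sum>r<N i. \<Sum>k<K. (cmod (cinner (?A ((T i ^^ k) (f i r))) h))\<^sup>2)"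
        unfolding coeff by (simp add: cinner_cadjoint[OF bounded_poly_operator])
      also have "\<dots> \<le> (\<Sum>i\<in>UNIV. \<Sum>r<N i. C\<^sup>2 * (\<Sum>k<K + d. (cmod (cinner ((T i ^^ k) (f i r)) h))\<^sup>2))"
      proof (intro sum_mono)
        fix i r assume r: "r \<in> {..<N i}"
        let ?c = "\<lambda>m. Poly_Mapping.lookup p m * (\<Prod>j\<in>- {i}. \<nu> i r j ^ Poly_Mapping.lookup m j)"
        have "cinner (?A ((T i ^^ k) (f i r))) h =
            (\<Sum>m\<in>Poly_Mapping.keys p. ?c m * cinner ((T i ^^ (k + Poly_Mapping.lookup m i)) (f i r)) h)" for k
          by (subst poly_operator_eigenvector[of i _ "\<nu> i r"])
            (use r in \<open>auto simp: cinner_sum_left cinner_scaleC_left intro: eig\<close>)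
        moreover have "cmod (\<Sum>m\<in>Poly_Mapping.keys p. ?c m * t ^ Poly_Mapping.lookup m i) \<le> C" if "cmod t = 1" for t
          using C(2)[of r i t] r that by (simp add: poly_eval_line_point)
        ultimately show "(\<Sum>k<K. (cmod (cinner (?A ((T i ^^ k) (f i r))) h))\<^sup>2)
            \<le> C\<^sup>2 * (\<Sum>k<K + d. (cmod (cinner ((T i ^^ k) (f i r)) h))\<^sup>2)"
          using d shift_polynomial_inequality[of "Poly_Mapping.keys p" "\<lambda>m. Poly_Mapping.lookup m i" d ?c C
              "\<lambda>k. cinner ((T i ^^ k) (f i r)) h" K] by simp
      qed
      also have "\<dots> = C\<^sup>2 * (\<Sum>k<K + d. \<Sum>i\<in>UNIV. defect_form i ((cadjoint (T i) ^^ k) h))"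
        unfolding coeff by (simp add: sum_distrib_left)
      \<comment> \<open>The longer truncation at \<open>K + d\<close> costs nothing: every
        telescoped sum for \<open>h\<close> is at most its squared norm.\<close>
      also have "\<dots> \<le> C\<^sup>2 * (norm h)\<^sup>2"
        unfolding telescoped_defect_forms by (intro mult_left_mono) auto
      finally show ?thesis .
    qed
    then show "\<exists>M. \<forall>K\<ge>M. (\<Sum>k<K. \<Sum>i\<in>UNIV. defect_form i ((cadjoint (T i) ^^ k) (cadjoint ?A h))) \<le> C\<^sup>2 * (norm h)\<^sup>2"
      by blast
  qed
  then have "norm (cadjoint ?A h) \<le> C * norm h" for h
    using C(1) by (simp add: abs_le_square_iff[symmetric] abs_mult flip: power_mult_distrib)
  from norm_cadjoint_le[OF bounded_clinear_cadjoint[OF bounded_poly_operator] this]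
  show ?thesis by (simp add: cadjoint_cadjoint[OF bounded_poly_operator])
qed

end

section \<open>The inequality on the variety\<close>

theorem theorem1p1:
  fixes T :: "'n::finite \<Rightarrow> 'h \<Rightarrow> 'h::{chilbert_space, second_countable_topology}"
  assumes "CARD('n) \<ge> 2"
    and "T \<in> class_B0"
    and "\<forall>i. finite_cdim (defect_space (T i))"
  shows "\<exists>W :: (complex ^ 'n) set.
    algebraic_variety W \<and> variety_dim W = 1 \<and> symmetric_variety W \<and>
    (\<forall>p :: 'n cpoly.
      ereal (onorm (poly_operator p T)) \<le>
        (SUP z \<in> W \<inter> closed_polydisc. ereal (cmod (poly_eval p z))))"
proof -
  have contr: "contraction (T i)" for i using assms(2) by (simp add: class_B0_def)
  interpret szego_zero_tuple T
  proof
    show "bounded_clinear (T i)" for i using contr by (simp add: contraction_def)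
    have "T i \<circ> T j = T j \<circ> T i" for i j using assms(2) by (simp add: class_B0_def)
    then show "T i (T j x) = T j (T i x)" for i j x by (metis comp_apply)
  qed (use assms(2) in \<open>simp add: class_B0_def\<close>)
  \<comment> \<open>For each \<open>i\<close> the defect of \<open>T i\<close> is decomposed into
    joint eigenvectors of the other \<open>T j\<close>, using the finite-dimensional defect
    space.\<close>
  have "\<forall>i. \<exists>F. (\<forall>(f, \<nu>) \<in> set F. \<forall>j\<in>- {i}. T j f = \<nu> j *\<^sub>C f \<and> cmod (\<nu> j) = 1) \<and>
    (\<forall>h. defect_form i h = (\<Sum>(f, \<nu>) \<leftarrow> F. (cmod (cinner h f))\<^sup>2))"
  proof
    fix i
    obtain B where "finite B" "defect_space (T i) = cspan B"
      using assms(3) by (auto simp: finite_cdim_def)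
    then show "\<exists>F. (\<forall>(f, \<nu>) \<in> set F. \<forall>j\<in>- {i}. T j f = \<nu> j *\<^sub>C f \<and> cmod (\<nu> j) = 1) \<and>
        (\<forall>h. defect_form i h = (\<Sum>(f, \<nu>) \<leftarrow> F. (cmod (cinner h f))\<^sup>2))"
      unfolding defect_form_def
      using defect_operator_positive_sqrt[OF contr[of i]]
      by (intro psd_invariant_decomposition[of B]) (auto simp: bounded commute intro!: defect_conjugation)
  qed
  from choice[OF this] obtain F where
    "\<forall>i. (\<forall>(f, \<nu>) \<in> set (F i). \<forall>j\<in>- {i}. T j f = \<nu> j *\<^sub>C f \<and> cmod (\<nu> j) = 1) \<and>
      (\<forall>h. defect_form i h = (\<Sum>(f, \<nu>) \<leftarrow> F i. (cmod (cinner h f))\<^sup>2))"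
    by (elim exE)
  then have F: "\<And>i f \<nu> j. (f, \<nu>) \<in> set (F i) \<Longrightarrow> j \<in> - {i} \<Longrightarrow> T j f = \<nu> j *\<^sub>C f \<and> cmod (\<nu> j) = 1"
    and form: "\<And>i h. defect_form i h = (\<Sum>(f, \<nu>) \<leftarrow> F i. (cmod (cinner h f))\<^sup>2)"
    by (blast, simp)
  define N where "N i = length (F i)" for i
  define f where "f i r = fst (F i ! r)" for i r
  define \<nu> where "\<nu> i r = snd (F i ! r)" for i r
  have F_nth: "(f i r, \<nu> i r) \<in> set (F i)" if "r < N i" for i r
    using that by (simp add: f_def \<nu>_def N_def)
  \<comment> \<open>The extra line keeps \<open>\<Lambda>\<close> nonempty even if all lists
    \<open>F i\<close> are empty; then \<open>W\<close> still has dimension 1 and meets the closed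
    polydisc.\<close>
  define \<Lambda> where "\<Lambda> = insert (undefined, \<lambda>_. 1) (\<Union>i. \<Union>r<N i. {(i, \<nu> i r)})"
  have fin: "finite \<Lambda>" "\<Lambda> \<noteq> {}" by (auto simp: \<Lambda>_def)
  have unit: "cmod (\<mu> j) = 1" if "(i, \<mu>) \<in> \<Lambda>" "j \<noteq> i" for i \<mu> j
    using that F[OF F_nth] by (auto simp: \<Lambda>_def)
  define W where "W = (\<Union>(i, \<mu>)\<in>\<Lambda>. coord_line i \<mu>)"
  \<comment> \<open>For \<open>cmod t = 1\<close> all coordinates are unimodular, so the circles on
    which the scalar bound is required lie in the closed polydisc.\<close>
  have point: "line_point i \<mu> t \<in> W \<inter> closed_polydisc" if "(i, \<mu>) \<in> \<Lambda>" "cmod t = 1" for i \<mu> t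
    using that unit[OF that(1)] by (auto simp: W_def coord_line_eq_range closed_polydisc_def line_point_def)
  have "algebraic_variety W"
    unfolding W_def by (intro algebraic_variety_UN fin) (auto intro: algebraic_variety_coord_line)
  moreover have "variety_dim W = 1" unfolding W_def by (rule variety_dim_lines[OF fin])
  moreover have "symmetric_variety W" unfolding W_def by (rule symmetric_lines) (rule unit)
  moreover have "ereal (onorm (poly_operator p T)) \<le> (SUP z \<in> W \<inter> closed_polydisc. ereal (cmod (poly_eval p z)))"
    (is "_ \<le> ?s") for p
  \<comment> \<open>A finite supremum serves as the constant \<open>C\<close>; an infinite one is
    trivial, and minus infinity is excluded by a point of the extra line.\<close>
  proof (cases ?s)
    case (real C)
    have C: "cmod (poly_eval p z) \<le> C" if "z \<in> W \<inter> closed_polydisc" for z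
    proof -
      have "ereal (cmod (poly_eval p z)) \<le> ?s" using that by (rule SUP_upper)
      then show ?thesis unfolding real by simp
    qed
    have "line_point undefined (\<lambda>_. 1) 1 \<in> W \<inter> closed_polydisc" by (rule point) (auto simp: \<Lambda>_def)
    then have "0 \<le> C" using C norm_ge_zero order_trans by blast
    have "norm (poly_operator p T x) \<le> C * norm x" for x
    proof (rule norm_poly_operator_le)
      show "pure_operator (operator_product T)" using assms(2) by (simp add: class_B0_def)
      show "defect_form i h = (\<Sum>r<N i. (cmod (cinner h (f i r)))\<^sup>2)" for i h
        by (simp add: form sum_list_sum_nth N_def f_def case_prod_unfold atLeast0LessThan)
      show "T j (f i r) = \<nu> i r j *\<^sub>C f i r" if "r < N i" "j \<in> - {i}" for i r j
        using F[OF F_nth[OF that(1)] that(2)] by blast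
      show "cmod (poly_eval p (line_point i (\<nu> i r) t)) \<le> C" if "r < N i" "cmod t = 1" for i r t
        by (intro C point) (use that in \<open>auto simp: \<Lambda>_def\<close>)
    qed (rule \<open>0 \<le> C\<close>)
    then have "onorm (poly_operator p T) \<le> C" by (intro onorm_bound \<open>0 \<le> C\<close>)
    then show ?thesis unfolding real by simp
  next
    case MInf
    have "line_point undefined (\<lambda>_. 1) 1 \<in> W \<inter> closed_polydisc" by (rule point) (auto simp: \<Lambda>_def)
    then have "ereal (cmod (poly_eval p (line_point undefined (\<lambda>_. 1) 1))) \<le> ?s" by (rule SUP_upper)
    then show ?thesis unfolding MInf by simp
  qed simp
  ultimately show ?thesis by blast
qed

end
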